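(* Consider a polynomial ensemble formed by $x_1,\ldots,x_N$, and assume that it is invertible (with functions $\varphi_l(x)=\varphi(a_l,x)$ on the interval $I\subseteq\mathbb{R}$, real parameters $a_1,\ldots,a_N$, function $F$ and contour $I'$ as in the definition of invertible ensemble). Then for $L\le N$ $$\begin{aligned} \mathbb{E}\left[\frac{\prod_{m=1}^{M} D_{N}(z_m)}{\prod_{l=1}^{L} D_{N}(y_l)}\right] =\;&\frac{(-1)^{L(L-1)/2}}{L!\,\Delta_M(z_1,\ldots,z_M)} \left[\prod_{j=1}^M \int_{I'}ds_j\, F(s_j,z_j)\prod_{n=1}^N(s_j-a_{n})\right]\Delta_M(s_1,\ldots,s_M)\\ &\times\left[\prod_{l=1}^{L}\int_I dv_l\left(\frac{v_{l}}{y_l}\right)^{N-L}\frac{\prod_{m=1}^M(z_m-v_l)}{\prod_{j=1}^{L}(y_j-v_{l})}\right]\Delta_L(v_1,\ldots,v_L)\\ &\times\left[\prod_{l=1}^{L}\oint_{C_l}\frac{du_l}{2\pi i}\,\frac{1}{\prod_{n=1}^{N}(u_{l}-a_n)}\,\frac{\varphi(u_{l},v_l)}{\prod_{j=1}^M(s_j-u_{l})}\right]\Delta_L(u_{1},\ldots,u_{L}), \end{aligned}$$ where $D_N(z)=\prod_{n=1}^N(z-x_n)$ denotes the characteristic polynomial associated with the random variables $x_1,\ldots,x_N$, the parameters $y_1,\ldots,y_L\in\mathbb{C}\setminus\mathbb{R}$ and $z_1,\ldots,z_M\in\mathbb{C}$ are pairwise distinct, and all contours $C_l$ with $l=1,\ldots,L$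 encircle the points $a_1,\ldots,a_N$ counter-clockwise.
   Context: The right-hand side of the formula is a nested multiple integral: the bracketed integrations act on everything to their right. Polynomial ensemble: a probability density on $I^N$, $I\subseteq\mathbb{R}$ an interval, of the form $\mathcal{P}(x_1,\ldots,x_N)=\mathcal{Z}_N^{-1}\Delta_N(x_1,\ldots,x_N)\det[\varphi_l(x_k)]_{k,l=1}^N$, where $\varphi_1,\ldots,\varphi_N$ are integrable real-valued functions on $I$ and the normalisation constant $\mathcal{Z}_N=\int_{I^N}\Delta_N(x_1,\ldots,x_N)\det[\varphi_l(x_k)]_{k,l=1}^N\,dx_1\cdots dx_N$ exists and is non-zero. $\mathbb{E}$ is expectation with respect to $\mathcal{P}$. Vandermonde determinant: $\Delta_K(w_1,\ldots,w_K)=\prod_{1\le i<j\le K}(w_i-w_j)$, with $\Delta_0=\Delta_1=1$; empty products equal $1$. Invertible ensemble: a polynomial ensemble such that $\varphi_l(x)=\varphi(a_l,x)$ for $l=1,\ldots,N$, where $a_1,\ldots,a_N$ are real parameters and $\varphi$ is analytic in both arguments, and such that: (i) there is a family $\{\pi_k\}_{k\ge0}$ of monic polynomials, $\deg\pi_k=k$, with $\pi_k(a)=\int_I dx\,x^k\varphi(a,x)$ for $k=0,1,\ldots$; (ii) there is a function $F:I'\times\mathbb{C}\to\mathbb{C}$, where $I'$ is a certain contour in the complex plane, such that $z^k=\int_{I'}ds\,F(s,z)\,\pi_k(s)$ for $k=0,1,\ldots$.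
   Formalization: The contours C_l are required not to pass through or enclose any of the points s_j (they may depend on the s_j), and to stay, with their interior, where φ is analytic; if C_l also encloses some s_j, the residue at u_l = s_j makes the formula false. *)

theory Defs
  imports
    "HOL-Complex_Analysis.Complex_Analysis"
    "HOL-Probability.Probability"
    "Jordan_Normal_Form.Determinant"
begin

text \<open>Families \<open>x\<^sub>1, \<dots>, x\<^sub>K\<close> are functions on \<^typ>\<open>nat\<close> of which only the values at
  \<open>0, \<dots>, K - 1\<close> matter; points of \<open>I\<^sup>N\<close> are the extensional functions of a product measure space.\<close>

definition vandermonde :: "nat \<Rightarrow> (nat \<Rightarrow> 'a::comm_ring_1) \<Rightarrow> 'a" where
  "vandermonde K w = (\<Prod>(i, j)\<in>{(i, j). i < j \<and> j < K}. w i - w j)"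

definition char_fun :: "nat \<Rightarrow> (nat \<Rightarrow> real) \<Rightarrow> complex \<Rightarrow> complex" where
  "char_fun N x z = (\<Prod>n<N. z - of_real (x n))"


subsection \<open>Polynomial ensembles\<close>

definition lebesgue_power :: "real set \<Rightarrow> nat \<Rightarrow> (nat \<Rightarrow> real) measure" where
  "lebesgue_power I N = (\<Pi>\<^sub>M n\<in>{..<N}. restrict_space lborel I)"

definition ensemble_weight :: "nat \<Rightarrow> (nat \<Rightarrow> real \<Rightarrow> real) \<Rightarrow> (nat \<Rightarrow> real) \<Rightarrow> real" where
  "ensemble_weight N \<phi>s x =
     vandermonde N x * Determinant.det (Matrix.mat N N (\<lambda>(k, l). \<phi>s l (x k)))"

definition ensemble_const :: "real set \<Rightarrow> nat \<Rightarrow> (nat \<Rightarrow> real \<Rightarrow> real) \<Rightarrow> real" where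
  "ensemble_const I N \<phi>s = (LINT x|lebesgue_power I N. ensemble_weight N \<phi>s x)"

definition ensemble_density ::
    "real set \<Rightarrow> nat \<Rightarrow> (nat \<Rightarrow> real \<Rightarrow> real) \<Rightarrow> (nat \<Rightarrow> real) \<Rightarrow> real" where
  "ensemble_density I N \<phi>s x = ensemble_weight N \<phi>s x / ensemble_const I N \<phi>s"

definition polynomial_ensemble :: "real set \<Rightarrow> nat \<Rightarrow> (nat \<Rightarrow> real \<Rightarrow> real) \<Rightarrow> bool" where
  "polynomial_ensemble I N \<phi>s \<longleftrightarrow>
     is_interval I \<and>
     (\<forall>l<N. set_integrable lborel I (\<phi>s l)) \<and>
     integrable (lebesgue_power I N) (ensemble_weight N \<phi>s) \<and>
     ensemble_const I N \<phi>s \<noteq> 0 \<and>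
     (AE x in lebesgue_power I N. 0 \<le> ensemble_density I N \<phi>s x)"

definition ensemble_measure ::
    "real set \<Rightarrow> nat \<Rightarrow> (nat \<Rightarrow> real \<Rightarrow> real) \<Rightarrow> (nat \<Rightarrow> real) measure" where
  "ensemble_measure I N \<phi>s =
     density (lebesgue_power I N) (\<lambda>x. ennreal (ensemble_density I N \<phi>s x))"

lemma prob_space_ensemble_measure:
  assumes "polynomial_ensemble I N \<phi>s"
  shows "prob_space (ensemble_measure I N \<phi>s)"
proof
  have int: "integrable (lebesgue_power I N) (ensemble_density I N \<phi>s)"
    using assms unfolding polynomial_ensemble_def ensemble_density_def[abs_def] by simp
  have "(\<integral>\<^sup>+x. ennreal (ensemble_density I N \<phi>s x) \<partial>lebesgue_power I N)
      = ennreal (LINT x|lebesgue_power I N. ensemble_density I N \<phi>s x)"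
    using assms int by (intro nn_integral_eq_integral) (auto simp: polynomial_ensemble_def)
  also have "(LINT x|lebesgue_power I N. ensemble_density I N \<phi>s x) = 1"
    using assms
    by (simp add: ensemble_density_def[abs_def] ensemble_const_def[symmetric] polynomial_ensemble_def)
  finally show "emeasure (ensemble_measure I N \<phi>s) (space (ensemble_measure I N \<phi>s)) = 1"
    using borel_measurable_integrable[OF int]
    by (simp add: ensemble_measure_def emeasure_density cong: nn_integral_cong)
qed


subsection \<open>Contours\<close>

text \<open>The contour \<open>I'\<close> may be unbounded (a line or a half-line, say), so it is parametrised over an
  arbitrary real interval \<open>J\<close> instead of \<open>{0..1}\<close>. As in \<^const>\<open>has_contour_integral\<close>, the integral
  is a gauge integral; in particular it covers conditionally convergent integrals.\<close>

definition contour_on :: "real set \<Rightarrow> (real \<Rightarrow> complex) \<Rightarrow> bool" where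
  "contour_on J \<gamma> \<longleftrightarrow>
     is_interval J \<and> (\<forall>a b. {a..b} \<subseteq> J \<longrightarrow> \<gamma> piecewise_C1_differentiable_on {a..b})"

definition has_integral_along ::
    "(complex \<Rightarrow> complex) \<Rightarrow> complex \<Rightarrow> real set \<Rightarrow> (real \<Rightarrow> complex) \<Rightarrow> bool" where
  "has_integral_along f i J \<gamma> \<longleftrightarrow>
     ((\<lambda>t. f (\<gamma> t) * vector_derivative \<gamma> (at t)) has_integral i) J"

definition integral_along ::
    "real set \<Rightarrow> (real \<Rightarrow> complex) \<Rightarrow> (complex \<Rightarrow> complex) \<Rightarrow> complex" where
  "integral_along J \<gamma> f = integral J (\<lambda>t. f (\<gamma> t) * vector_derivative \<gamma> (at t))"

text \<open>\<open>c\<close> is a closed path encircling each point of \<open>A\<close> once counter-clockwise, and it does not wind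
  around any point outside the domain of analyticity \<open>U\<close>.\<close>

definition encircles :: "complex set \<Rightarrow> complex set \<Rightarrow> (real \<Rightarrow> complex) \<Rightarrow> bool" where
  "encircles U A c \<longleftrightarrow>
     valid_path c \<and> pathfinish c = pathstart c \<and> path_image c \<subseteq> U - A \<and>
     (\<forall>w\<in>A. winding_number c w = 1) \<and> (\<forall>w. w \<notin> U \<longrightarrow> winding_number c w = 0)"


subsection \<open>Invertible ensembles\<close>

text \<open>\<open>U\<close> is the complex domain of the first argument of \<open>\<phi>\<close>. Analyticity in the second argument is
  real analyticity on \<open>I\<close>, i.e. holomorphy near each point of \<open>I\<close>.\<close>

definition invertible_ensemble ::
    "real set \<Rightarrow> nat \<Rightarrow> (nat \<Rightarrow> real \<Rightarrow> real) \<Rightarrow> (nat \<Rightarrow> real) \<Rightarrow>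
     complex set \<Rightarrow> (complex \<Rightarrow> complex \<Rightarrow> complex) \<Rightarrow> (nat \<Rightarrow> complex poly) \<Rightarrow>
     real set \<Rightarrow> (real \<Rightarrow> complex) \<Rightarrow> (complex \<Rightarrow> complex \<Rightarrow> complex) \<Rightarrow> bool" where
  "invertible_ensemble I N \<phi>s a U \<phi> \<pi> J \<gamma> F \<longleftrightarrow>
     polynomial_ensemble I N \<phi>s \<and>
     open U \<and> connected U \<and>
     (\<forall>x\<in>I. (\<lambda>u. \<phi> u (of_real x)) analytic_on U) \<and>
     (\<forall>u\<in>U. \<phi> u analytic_on (of_real ` I)) \<and>
     (\<forall>l<N. of_real (a l) \<in> U \<and> (\<forall>x\<in>I. of_real (\<phi>s l x) = \<phi> (of_real (a l)) (of_real x))) \<and>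
     (\<forall>k. degree (\<pi> k) = k \<and> lead_coeff (\<pi> k) = 1) \<and>
     (\<forall>k. \<forall>b::real. of_real b \<in> U \<longrightarrow>
        set_integrable lborel I (\<lambda>x. of_real (x ^ k) * \<phi> (of_real b) (of_real x)) \<and>
        poly (\<pi> k) (of_real b) = (LINT x:I|lborel. of_real (x ^ k) * \<phi> (of_real b) (of_real x))) \<and>
     contour_on J \<gamma> \<and>
     (\<forall>z k. has_integral_along (\<lambda>s. F s z * poly (\<pi> k) s) (z ^ k) J \<gamma>)"


subsection \<open>Nested integrals\<close>

text \<open>If \<open>T j\<close> is the operator \<open>g \<mapsto> \<integral>dw\<^sub>j k\<^sub>j(w\<^sub>j) g(w\<^sub>j)\<close>, then \<open>nested_integral T n f\<close> is
  \<open>\<integral>dw\<^sub>0 k\<^sub>0(w\<^sub>0) \<cdots> \<integral>dw\<^bsub>n-1\<^esub> k\<^bsub>n-1\<^esub>(w\<^bsub>n-1\<^esub>) f(w\<^sub>0, \<dots>, w\<^bsub>n-1\<^esub>)\<close>, with \<open>w\<^sub>0\<close> outermost. The variables from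
  index \<open>n\<close> on are set to \<open>0\<close>.\<close>

primrec nested_integral ::
    "(nat \<Rightarrow> ('a::zero \<Rightarrow> complex) \<Rightarrow> complex) \<Rightarrow> nat \<Rightarrow> ((nat \<Rightarrow> 'a) \<Rightarrow> complex) \<Rightarrow> complex" where
  "nested_integral T 0 f = f (\<lambda>_. 0)"
| "nested_integral T (Suc n) f = nested_integral T n (\<lambda>w. T n (\<lambda>t. f (w(n := t))))"

end

theory Submission
  imports Defs
begin

text \<open>Both sides reduce to the same finite sum over permutations \<open>\<sigma>\<close> of the \<open>a\<^sub>n\<close>. Write \<open>K = N - L\<close>.

  On the left, multivariate Lagrange interpolation and Cauchy's determinant express
  \<open>\<Delta>\<^sub>N(x) / \<Prod> D\<^sub>N(y\<^sub>l)\<close> as the antisymmetrisation of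
  \<open>\<Delta>\<^sub>L(v) \<Delta>\<^sub>K(w) \<Prod> (v\<^sub>l / y\<^sub>l)\<^sup>K / \<Prod> (y\<^sub>j - v\<^sub>l)\<close>, where \<open>x = (v, w)\<close>. The factors \<open>z\<^sub>m - w\<^sub>n\<close>
  merge with \<open>\<Delta>\<^sub>M(z) \<Delta>\<^sub>K(w)\<close> into \<open>\<Delta>\<^bsub>M+K\<^esub>(z, w)\<close>, so the integral factorises into
  one-dimensional ones, and those over the \<open>w\<^sub>n\<close> turn powers of \<open>w\<^sub>n\<close> into values of the \<open>\<pi>\<^sub>k\<close>.

  On the right, the contour integrals are sums over the residues \<open>u\<^sub>l = a\<^sub>n\<close>, in which \<open>\<Delta>\<^sub>L(u)\<close> leaves
  only the injective choices. The remaining \<open>a\<^sub>n\<close>, say \<open>b\<close>, contribute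
  \<open>\<Delta>\<^sub>M(s) \<Delta>\<^sub>K(b) \<Prod> (s\<^sub>j - b\<^sub>n) = \<Delta>\<^bsub>M+K\<^esub>(s, b)\<close>; expanding this Vandermonde determinant in
  the \<open>\<pi>\<^sub>k\<close> instead of powers, (ii) turns each \<open>\<pi>\<^sub>k(s\<^sub>j)\<close> into the power \<open>z\<^sub>j\<^sup>k\<close>.\<close>


subsection \<open>Vandermonde determinants\<close>

lemma prod_lessThan_add:
  fixes L K :: nat
  shows "(\<Prod>k<L + K. f k) = (\<Prod>l<L. f l) * (\<Prod>n<K. f (L + n))"
  by (induction K) (simp_all add: mult_ac)

lemma vandermonde_altdef:
  "vandermonde K w = (\<Prod>i<K. \<Prod>m\<in>{i<..<K}. w i - w m)"
proof -
  have "{(i, j). i < j \<and> j < K} = Sigma {..<K} (\<lambda>i. {i<..<K})"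
    by auto
  then show ?thesis
    by (simp add: vandermonde_def prod.Sigma)
qed

lemma vandermonde_cong:
  "(\<And>i. i < K \<Longrightarrow> w i = w' i) \<Longrightarrow> vandermonde K w = vandermonde K w'"
  unfolding vandermonde_altdef by (intro prod.cong) auto

lemma vandermonde_Suc:
  "vandermonde (Suc K) w = vandermonde K w * (\<Prod>i<K. w i - w K)"
proof -
  have "{i<..<Suc K} = insert K {i<..<K}" if "i < K" for i
    using that by auto
  then have "(\<Prod>m\<in>{i<..<Suc K}. w i - w m) = (\<Prod>m\<in>{i<..<K}. w i - w m) * (w i - w K)"
    if "i < K" for i
    using that by (simp add: mult.commute)
  then have "(\<Prod>i<K. \<Prod>m\<in>{i<..<Suc K}. w i - w m)
      = (\<Prod>i<K. (\<Prod>m\<in>{i<..<K}. w i - w m) * (w i - w K))"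
    by (intro prod.cong) auto
  moreover have "{K<..<Suc K} = {}" by auto
  ultimately show ?thesis
    unfolding vandermonde_altdef by (simp add: prod.distrib)
qed

text \<open>Serves in both directions: it cuts the Vandermonde of all points along a choice of
  \<open>L\<close> of them, and it absorbs the cross factors \<open>z m - w n\<close> or
  \<open>s j - b n\<close> into one Vandermonde of \<open>M + K\<close> points.\<close>

lemma vandermonde_add:
  "vandermonde (M + K) w =
     vandermonde M w * (\<Prod>i<M. \<Prod>n<K. w i - w (M + n)) * vandermonde K (\<lambda>n. w (M + n))"
proof (induction K)
  case 0
  show ?case by (simp add: vandermonde_def)
next
  case (Suc K)
  then show ?case
    by (simp add: vandermonde_Suc prod_lessThan_add prod.distrib mult_ac)
qed

lemma vandermonde_eq_0:
  assumes "i < K" "j < K" "i \<noteq> j" "w i = w j"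
  shows "vandermonde K w = 0"
proof -
  have *: "vandermonde K w = 0" if "i < j" "j < K" "w i = w j" for i j
  proof -
    have "(\<Prod>m\<in>{i<..<K}. w i - w m) = 0"
      using that by (intro prod_zero) auto
    then show ?thesis
      unfolding vandermonde_altdef using that by (intro prod_zero[OF finite_lessThan bexI[of _ i]]) auto
  qed
  show ?thesis
    using *[of i j] *[of j i] assms by (cases "i < j") auto
qed

lemma vandermonde_neq_0:
  fixes w :: "nat \<Rightarrow> 'a::idom"
  assumes "inj_on w {..<K}"
  shows "vandermonde K w \<noteq> 0"
  using assms by (auto simp: vandermonde_altdef prod_zero_iff dest!: inj_onD)

text \<open>The matrix is the matrix of powers times a matrix of coefficients. Since the degrees
  fall by one from column to column, the latter is lower triangular with unit diagonal, so passing
  to another monic basis leaves the determinant unchanged.\<close>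

lemma det_monic_family:
  fixes q :: "nat \<Rightarrow> 'a::idom poly"
  assumes q: "\<And>j. j < K \<Longrightarrow> degree (q j) = K - 1 - j" "\<And>j. j < K \<Longrightarrow> lead_coeff (q j) = 1"
  shows "Determinant.det (Matrix.mat K K (\<lambda>(i, j). poly (q j) (w i)))
       = Determinant.det (Matrix.mat K K (\<lambda>(i, j). w i ^ (K - 1 - j)))"
proof -
  define C where "C = Matrix.mat K K (\<lambda>(k, j). coeff (q j) (K - 1 - k))"
  define V where "V = Matrix.mat K K (\<lambda>(i, j). w i ^ (K - 1 - j))"
  have "Matrix.mat K K (\<lambda>(i, j). poly (q j) (w i)) = V * C"
  proof (rule eq_matI)
    fix i j assume "i < dim_row (V * C)" "j < dim_col (V * C)"
    then have ij: "i < K" "j < K" by (auto simp: V_def C_def)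
    have "poly (q j) (w i) = (\<Sum>k<K. coeff (q j) k * w i ^ k)"
      unfolding poly_altdef using q(1)[OF ij(2)] ij
      by (intro sum.mono_neutral_left) (auto simp: coeff_eq_0)
    also have "\<dots> = (\<Sum>k<K. coeff (q j) (K - 1 - k) * w i ^ (K - 1 - k))"
      using sum.nat_diff_reindex[of "\<lambda>k. coeff (q j) k * w i ^ k" K] by simp
    also have "\<dots> = (V * C) $$ (i, j)"
      using ij by (simp add: V_def C_def scalar_prod_def lessThan_atLeast0 mult.commute)
    finally show "Matrix.mat K K (\<lambda>(i, j). poly (q j) (w i)) $$ (i, j) = (V * C) $$ (i, j)"
      using ij by simp
  qed (auto simp: V_def C_def)
  moreover have "Determinant.det C = 1"
  proof -
    have "Determinant.det C = prod_list (diag_mat C)"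
    proof (rule det_lower_triangular[of K])
      fix i j assume "i < j" "j < K"
      then show "C $$ (i, j) = 0"
        using q(1)[of j] by (auto simp: C_def intro!: coeff_eq_0)
    qed (auto simp: C_def)
    also have "\<dots> = (\<Prod>i<K. C $$ (i, i))"
      by (simp add: prod_list_diag_prod C_def lessThan_atLeast0)
    also have "\<dots> = 1"
      using q by (intro prod.neutral) (auto simp: C_def)
    finally show ?thesis .
  qed
  moreover have "Determinant.det (V * C) = Determinant.det V * Determinant.det C"
    by (rule det_mult[of _ K]) (auto simp: V_def C_def)
  ultimately show ?thesis
    by (simp add: V_def)
qed

text \<open>In the Newton basis \<open>\<Prod>\<^bsub>m>j\<^esub> (x - w\<^sub>m)\<close> the matrix is triangular.\<close>

lemma vandermonde_det:
  fixes q :: "nat \<Rightarrow> 'a::idom poly"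
  assumes q: "\<And>k. degree (q k) = k" "\<And>k. lead_coeff (q k) = 1"
  shows "vandermonde K w = Determinant.det (Matrix.mat K K (\<lambda>(i, j). poly (q (K - 1 - j)) (w i)))"
proof -
  define r where "r = (\<lambda>j. \<Prod>m\<in>{j<..<K}. [:- w m, 1:])"
  define R where "R = Matrix.mat K K (\<lambda>(i, j). poly (r j) (w i))"
  have "degree (r j) = card {j<..<K}" for j
    unfolding r_def by (subst degree_prod_eq_sum_degree) auto
  then have deg: "degree (r j) = K - 1 - j" for j by simp
  have lead: "lead_coeff (r j) = 1" for j
    unfolding r_def by (simp add: lead_coeff_prod)
  have "Determinant.det R = prod_list (diag_mat R)"
  proof (rule det_upper_triangular[of _ K])
    show "upper_triangular R"
    proof (rule upper_triangularI)
      fix i j assume "j < i" "i < dim_row R"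
      then show "R $$ (i, j) = 0"
        by (auto simp: R_def r_def poly_prod intro!: bexI[of _ i])
    qed
  qed (auto simp: R_def)
  also have "\<dots> = vandermonde K w"
    by (simp add: prod_list_diag_prod R_def lessThan_atLeast0 vandermonde_altdef r_def poly_prod)
  finally have "vandermonde K w = Determinant.det R" by simp
  also have "\<dots> = Determinant.det (Matrix.mat K K (\<lambda>(i, j). w i ^ (K - 1 - j)))"
    unfolding R_def using deg lead by (intro det_monic_family) auto
  also have "\<dots> = Determinant.det (Matrix.mat K K (\<lambda>(i, j). poly (q (K - 1 - j)) (w i)))"
    using q by (intro det_monic_family[symmetric]) auto
  finally show ?thesis .
qed

section \<open>Permutation expansions and antisymmetry\<close>

abbreviation perms :: "nat \<Rightarrow> (nat \<Rightarrow> nat) set" where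
  "perms n \<equiv> {p. p permutes {..<n}}"

lemma det_mat_expand:
  "Determinant.det (Matrix.mat n n f) = (\<Sum>p\<in>perms n. of_int (sign p) * (\<Prod>i<n. f (i, p i)))"
proof -
  have "p i < n" if "p permutes {..<n}" "i < n" for p i
    using permutes_in_image[OF that(1)] that(2) by auto
  then show ?thesis
    by (subst det_def'[of _ n]) (auto simp: lessThan_atLeast0[symmetric] intro!: sum.cong prod.cong)
qed

text \<open>The free choice of the monic basis is what lets both sides meet: powers suit the moments
  over the interval, the \<open>\<pi>\<close> suit property (ii). The exponents descend because
  \<open>vandermonde\<close> multiplies \<open>w i - w j\<close> for \<open>i < j\<close>.\<close>

lemma vandermonde_expand:
  fixes q :: "nat \<Rightarrow> 'a::idom poly"
  assumes "\<And>k. degree (q k) = k" "\<And>k. lead_coeff (q k) = 1"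
  shows "vandermonde K w = (\<Sum>p\<in>perms K. of_int (sign p) * (\<Prod>i<K. poly (q (K - 1 - p i)) (w i)))"
  by (subst vandermonde_det[OF assms]) (simp add: det_mat_expand)

lemma vandermonde_expand_powers:
  fixes w :: "nat \<Rightarrow> 'a::idom"
  shows "vandermonde K w = (\<Sum>p\<in>perms K. of_int (sign p) * (\<Prod>i<K. w i ^ (K - 1 - p i)))"
  using vandermonde_expand[of "monom 1" K w] by (simp add: degree_monom_eq poly_monom)

lemma vandermonde_mult_prod:
  fixes x :: "nat \<Rightarrow> 'a::idom"
  shows "vandermonde L x * (\<Prod>l<L. g l) =
    (\<Sum>\<tau>\<in>perms L. of_int (sign \<tau>) * (\<Prod>l<L. g l * x l ^ (L - 1 - \<tau> l)))"
  by (simp add: vandermonde_expand_powers sum_distrib_left sum_distrib_right prod.distrib mult_ac)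

lemma det_perm_rows:
  assumes "\<sigma> \<in> perms n"
  shows "Determinant.det (Matrix.mat n n (\<lambda>(k, l). f (\<sigma> k) l))
       = of_int (sign \<sigma>) * Determinant.det (Matrix.mat n n (\<lambda>(k, l). f k l))"
proof -
  have \<sigma>: "\<sigma> permutes {0..<n}"
    using assms by (simp add: lessThan_atLeast0)
  have "Matrix.mat n n (\<lambda>(k, l). f (\<sigma> k) l)
      = Matrix.mat n n (\<lambda>(i, j). Matrix.mat n n (\<lambda>(k, l). f k l) $$ (\<sigma> i, j))"
    using permutes_in_image[OF \<sigma>] by (intro eq_matI) auto
  then show ?thesis
    using det_permute_rows[OF _ \<sigma>, of "Matrix.mat n n (\<lambda>(k, l). f k l)"] by simp
qed

lemma vandermonde_perm:
  fixes w :: "nat \<Rightarrow> 'a::idom"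
  assumes "\<sigma> \<in> perms K"
  shows "vandermonde K (\<lambda>i. w (\<sigma> i)) = of_int (sign \<sigma>) * vandermonde K w"
proof -
  have v: "vandermonde K w = Determinant.det (Matrix.mat K K (\<lambda>(i, j). w i ^ (K - 1 - j)))"
    for w :: "nat \<Rightarrow> 'a"
    using vandermonde_det[of "monom 1" K w] by (simp add: degree_monom_eq poly_monom)
  show ?thesis
    unfolding v by (rule det_perm_rows[OF assms])
qed

text \<open>Each pair occurs in both orders; one reversal per pair gives the sign, which is the
  source of the sign in the final formula.\<close>

lemma prod_offdiagonal_differences:
  fixes w :: "nat \<Rightarrow> 'a::comm_ring_1"
  shows "(\<Prod>l<L. \<Prod>m\<in>{..<L} - {l}. w l - w m) = (-1) ^ (L * (L - 1) div 2) * vandermonde L w ^ 2"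
proof (induction L)
  case 0
  show ?case by (simp add: vandermonde_def)
next
  case (Suc L)
  have "{..<Suc L} - {l} = insert L ({..<L} - {l})" if "l < L" for l
    using that by auto
  then have "(\<Prod>m\<in>{..<Suc L} - {l}. w l - w m) = (\<Prod>m\<in>{..<L} - {l}. w l - w m) * (w l - w L)"
    if "l < L" for l
    using that by (simp add: mult.commute)
  then have "(\<Prod>l<L. \<Prod>m\<in>{..<Suc L} - {l}. w l - w m)
      = (\<Prod>l<L. (\<Prod>m\<in>{..<L} - {l}. w l - w m) * (w l - w L))"
    by (intro prod.cong) auto
  moreover have "{..<Suc L} - {L} = {..<L}" by auto
  moreover have "(\<Prod>m<L. w L - w m) = (-1) ^ L * (\<Prod>m<L. w m - w L)"
    by (subst minus_diff_eq[symmetric], subst prod_uminus) simp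
  moreover have "Suc L * (Suc L - 1) div 2 = L * (L - 1) div 2 + L"
    by (cases L) (auto simp: algebra_simps)
  ultimately show ?case
    by (simp add: prod.distrib Suc vandermonde_Suc power_add power2_eq_square mult_ac)
qed

text \<open>The products of differences are at once Lagrange weights and residues of
  \<open>1 / (\<Prod>m<L + K. t - w m)\<close>. For \<open>l < L\<close> the product splits into
  differences to the other selected points and to the unselected ones. The first kind multiplies up
  to a signed square of the Vandermonde of the selected points, and \<open>vandermonde_add\<close>
  then leaves only the Vandermonde of the unselected points over the full one.\<close>

lemma vandermonde_partial_fraction:
  fixes w :: "nat \<Rightarrow> 'a::field"
  assumes \<sigma>: "\<sigma> \<in> perms (L + K)" and w: "inj_on w {..<L + K}"
  shows "vandermonde L (\<lambda>l. w (\<sigma> l)) * (\<Prod>l<L. 1 / (\<Prod>m\<in>{..<L + K} - {\<sigma> l}. w (\<sigma> l) - w m))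
    = (-1) ^ (L * (L - 1) div 2) * of_int (sign \<sigma>) * vandermonde K (\<lambda>n. w (\<sigma> (L + n)))
        / vandermonde (L + K) w"
proof -
  define x where "x = (\<lambda>i. w (\<sigma> i))"
  have \<sigma>': "\<sigma> permutes {..<L + K}" using \<sigma> by simp
  have x: "inj_on x {..<L + K}"
    using comp_inj_on[of \<sigma> "{..<L + K}" w] w \<sigma>'
    by (simp add: x_def permutes_inj_on permutes_image o_def)
  have reindex: "(\<Prod>m\<in>{..<L + K} - {\<sigma> l}. w (\<sigma> l) - w m)
      = (\<Prod>m\<in>{..<L} - {l}. x l - x m) * (\<Prod>n<K. x l - x (L + n))" if "l < L" for l
  proof -
    have "(\<Prod>m\<in>{..<L + K} - {\<sigma> l}. w (\<sigma> l) - w m) = (\<Prod>m\<in>{..<L + K} - {l}. x l - x m)"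
      unfolding x_def
    proof (rule prod.reindex_bij_betw[symmetric, of \<sigma> _ _ "\<lambda>m. w (\<sigma> l) - w m"])
      show "bij_betw \<sigma> ({..<L + K} - {l}) ({..<L + K} - {\<sigma> l})"
        using bij_betw_DiffI[OF permutes_imp_bij[OF \<sigma>'], of "{l}" "{\<sigma> l}"] that
        using permutes_in_image[OF \<sigma>'] by auto
    qed
    also have "{..<L + K} - {l} = ({..<L} - {l}) \<union> (+) L ` {..<K}"
      using that image_add_atLeastLessThan[of L 0 K] by (auto simp: lessThan_atLeast0 add.commute)
    also have "(\<Prod>m\<in>\<dots>. x l - x m) = (\<Prod>m\<in>{..<L} - {l}. x l - x m) * (\<Prod>n<K. x l - x (L + n))"
      by (subst prod.union_disjoint) (auto simp: prod.reindex)
    finally show ?thesis .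
  qed
  have nz: "vandermonde (L + K) x \<noteq> 0"
    by (rule vandermonde_neq_0[OF x])
  have split: "vandermonde (L + K) x = vandermonde L x * (\<Prod>l<L. \<Prod>n<K. x l - x (L + n))
      * vandermonde K (\<lambda>n. x (L + n))"
    by (rule vandermonde_add)
  have sgn: "vandermonde (L + K) x = of_int (sign \<sigma>) * vandermonde (L + K) w"
    unfolding x_def by (rule vandermonde_perm[OF \<sigma>])
  have s2: "of_int (sign \<sigma>) * of_int (sign \<sigma>) = (1::'a)" "of_int (sign \<sigma>) \<noteq> (0::'a)"
    by (auto simp: sign_def)
  have m2: "(-1) ^ k * (-1) ^ k = (1::'a)" "(-1) ^ k \<noteq> (0::'a)" for k
    by (simp_all add: power_mult_distrib[symmetric])
  have "(\<Prod>l<L. 1 / (\<Prod>m\<in>{..<L + K} - {\<sigma> l}. w (\<sigma> l) - w m))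
      = 1 / ((\<Prod>l<L. \<Prod>m\<in>{..<L} - {l}. x l - x m) * (\<Prod>l<L. \<Prod>n<K. x l - x (L + n)))"
    by (simp add: prod_dividef reindex prod.distrib)
  also have "\<dots> = 1 / ((-1) ^ (L * (L - 1) div 2) * vandermonde L x ^ 2
      * (\<Prod>l<L. \<Prod>n<K. x l - x (L + n)))"
    by (simp add: prod_offdiagonal_differences)
  finally have "vandermonde L x * (\<Prod>l<L. 1 / (\<Prod>m\<in>{..<L + K} - {\<sigma> l}. w (\<sigma> l) - w m))
      = vandermonde K (\<lambda>n. x (L + n)) / ((-1) ^ (L * (L - 1) div 2) * vandermonde (L + K) x)"
    using nz m2(2) unfolding split by (simp add: power2_eq_square)
  also have "\<dots> = (-1) ^ (L * (L - 1) div 2) * vandermonde K (\<lambda>n. x (L + n)) / vandermonde (L + K) x"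
    by (cases "even (L * (L - 1) div 2)") simp_all
  also have "\<dots> = (-1) ^ (L * (L - 1) div 2) * of_int (sign \<sigma>) * vandermonde K (\<lambda>n. x (L + n))
      / vandermonde (L + K) w"
    unfolding sgn using s2 by (auto simp: sign_def)
  finally show ?thesis
    by (simp add: x_def)
qed

subsection \<open>Permutations and injections\<close>

lemma exists_permutation_extending:
  assumes "\<iota> \<in> {..<L} \<rightarrow>\<^sub>E {..<N}" "inj_on \<iota> {..<L}" "L \<le> N"
  obtains \<sigma> where "\<sigma> \<in> perms N" "\<And>l. l < L \<Longrightarrow> \<sigma> l = \<iota> l"
proof -
  have sub: "\<iota> ` {..<L} \<subseteq> {..<N}" using assms by auto
  then have "card ({..<N} - \<iota> ` {..<L}) = card {L..<N}"
    using assms by (simp add: card_Diff_subset card_image)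
  then obtain f where f: "bij_betw f {L..<N} ({..<N} - \<iota> ` {..<L})"
    using finite_same_card_bij by (metis finite_Diff finite_atLeastLessThan finite_lessThan)
  define \<sigma> where "\<sigma> = (\<lambda>i. if i < L then \<iota> i else if i < N then f i else i)"
  have "bij_betw \<sigma> ({..<L} \<union> {L..<N}) (\<iota> ` {..<L} \<union> ({..<N} - \<iota> ` {..<L}))"
  proof (rule bij_betw_combine)
    show "bij_betw \<sigma> {..<L} (\<iota> ` {..<L})"
      using assms by (subst bij_betw_cong[of _ _ \<iota>]) (auto simp: \<sigma>_def bij_betw_def)
    show "bij_betw \<sigma> {L..<N} ({..<N} - \<iota> ` {..<L})"
      using f by (subst bij_betw_cong[of _ _ f]) (auto simp: \<sigma>_def)
  qed auto
  moreover have "{..<L} \<union> {L..<N} = {..<N}" using assms(3) by auto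
  moreover have "\<iota> ` {..<L} \<union> ({..<N} - \<iota> ` {..<L}) = {..<N}" using sub by auto
  ultimately have "bij_betw \<sigma> {..<N} {..<N}" by simp
  then have "\<sigma> permutes {..<N}"
    by (rule bij_imp_permutes) (use assms(3) in \<open>simp add: \<sigma>_def\<close>)
  then show thesis
    by (intro that[of \<sigma>]) (auto simp: \<sigma>_def)
qed

lemma card_permutations_extending:
  assumes "\<iota> \<in> {..<L} \<rightarrow>\<^sub>E {..<N}" "inj_on \<iota> {..<L}" "L \<le> N"
  shows "card {\<sigma>\<in>perms N. restrict \<sigma> {..<L} = \<iota>} = fact (N - L)"
proof -
  obtain \<sigma>0 where s0: "\<sigma>0 \<in> perms N" "\<And>l. l < L \<Longrightarrow> \<sigma>0 l = \<iota> l"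
    using exists_permutation_extending[OF assms] by blast
  have r_iff: "restrict \<sigma> {..<L} = \<iota> \<longleftrightarrow> (\<forall>l<L. \<sigma> l = \<iota> l)" for \<sigma>
    using assms(1) by (auto simp: restrict_def PiE_def extensional_def fun_eq_iff)
  have "bij_betw (\<lambda>\<rho>. \<sigma>0 \<circ> \<rho>) {\<rho>. \<rho> permutes {L..<N}} {\<sigma>\<in>perms N. restrict \<sigma> {..<L} = \<iota>}"
  proof (rule bij_betw_byWitness[where f' = "\<lambda>\<sigma>. inv_into UNIV \<sigma>0 \<circ> \<sigma>"])
    have s0p: "\<sigma>0 permutes {..<N}" using s0 by simp
    note inv = permutes_inverses[OF s0p]
    show "\<forall>a\<in>{\<rho>. \<rho> permutes {L..<N}}. inv_into UNIV \<sigma>0 \<circ> (\<sigma>0 \<circ> a) = a"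
      using inv by (auto simp: fun_eq_iff)
    show "\<forall>a'\<in>{\<sigma>\<in>perms N. restrict \<sigma> {..<L} = \<iota>}. \<sigma>0 \<circ> (inv_into UNIV \<sigma>0 \<circ> a') = a'"
      using inv by (auto simp: fun_eq_iff)
    show "(\<circ>) \<sigma>0 ` {\<rho>. \<rho> permutes {L..<N}} \<subseteq> {\<sigma>\<in>perms N. restrict \<sigma> {..<L} = \<iota>}"
    proof (rule image_subsetI)
      fix \<rho> assume "\<rho> \<in> {\<rho>. \<rho> permutes {L..<N}}"
      then have \<rho>: "\<rho> permutes {L..<N}" by simp
      have "\<rho> permutes {..<N}"
        by (rule permutes_subset[OF \<rho>]) auto
      then have "\<sigma>0 \<circ> \<rho> permutes {..<N}"
        by (rule permutes_compose[OF _ s0p])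
      moreover have "restrict (\<sigma>0 \<circ> \<rho>) {..<L} = \<iota>"
        unfolding r_iff using s0(2) permutes_not_in[OF \<rho>] by auto
      ultimately show "\<sigma>0 \<circ> \<rho> \<in> {\<sigma>\<in>perms N. restrict \<sigma> {..<L} = \<iota>}" by simp
    qed
    show "(\<circ>) (inv_into UNIV \<sigma>0) ` {\<sigma>\<in>perms N. restrict \<sigma> {..<L} = \<iota>} \<subseteq> {\<rho>. \<rho> permutes {L..<N}}"
    proof (rule image_subsetI)
      fix \<sigma> assume "\<sigma> \<in> {\<sigma>\<in>perms N. restrict \<sigma> {..<L} = \<iota>}"
      then have s: "\<sigma> permutes {..<N}" and r: "restrict \<sigma> {..<L} = \<iota>" by auto
      have p: "inv_into UNIV \<sigma>0 \<circ> \<sigma> permutes {..<N}"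
        by (rule permutes_compose[OF s permutes_inv[OF s0p]])
      have "(inv_into UNIV \<sigma>0 \<circ> \<sigma>) l = l" if "l < L" for l
        using r that s0(2)[OF that] inv(2)[of l] unfolding r_iff by simp
      then have "inv_into UNIV \<sigma>0 \<circ> \<sigma> permutes {L..<N}"
        by (intro permutes_superset[OF p]) (force simp: not_le)
      then show "inv_into UNIV \<sigma>0 \<circ> \<sigma> \<in> {\<rho>. \<rho> permutes {L..<N}}"
        by simp
    qed
  qed
  then have "card {\<sigma>\<in>perms N. restrict \<sigma> {..<L} = \<iota>} = card {\<rho>. \<rho> permutes {L..<N}}"
    by (simp add: bij_betw_same_card)
  also have "\<dots> = fact (N - L)"
    by (rule card_permutations) auto
  finally show ?thesis .
qed

text \<open>Grouping permutations by their first \<open>L\<close> values meets every injection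
  \<open>fact (N - L)\<close> times. Non-injective maps may be added because \<open>h\<close>
  vanishes there; in the applications \<open>h\<close> contains a Vandermonde factor.\<close>

lemma sum_perms_eq_sum_injections:
  fixes h :: "(nat \<Rightarrow> nat) \<Rightarrow> 'a::{comm_semiring_1, semiring_char_0}"
  assumes "L \<le> N" and h0: "\<And>\<iota>. \<not> inj_on \<iota> {..<L} \<Longrightarrow> h \<iota> = 0"
  shows "(\<Sum>\<sigma>\<in>perms N. h (restrict \<sigma> {..<L}))
       = fact (N - L) * (\<Sum>\<iota>\<in>{..<L} \<rightarrow>\<^sub>E {..<N}. h \<iota>)"
proof -
  let ?E = "{..<L} \<rightarrow>\<^sub>E {..<N}"
  have "(\<Sum>\<sigma>\<in>perms N. h (restrict \<sigma> {..<L}))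
      = (\<Sum>\<iota>\<in>?E. \<Sum>\<sigma>\<in>{\<sigma>\<in>perms N. restrict \<sigma> {..<L} = \<iota>}. h (restrict \<sigma> {..<L}))"
  proof (rule sum.group[symmetric])
    show "finite (perms N)" by (simp add: finite_permutations)
    show "finite ?E" by (intro finite_PiE) auto
    show "(\<lambda>\<sigma>. restrict \<sigma> {..<L}) ` perms N \<subseteq> ?E"
    proof (rule image_subsetI)
      fix \<sigma> assume "\<sigma> \<in> perms N"
      then have "\<sigma> permutes {..<N}" by simp
      then show "restrict \<sigma> {..<L} \<in> ?E"
        using assms(1) permutes_in_image[of \<sigma> "{..<N}"] by (intro restrict_PiE_iff[THEN iffD2]) auto
    qed
  qed
  also have "\<dots> = (\<Sum>\<iota>\<in>?E. fact (N - L) * h \<iota>)"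
  proof (rule sum.cong[OF refl])
    fix \<iota> assume \<iota>: "\<iota> \<in> ?E"
    have "(\<Sum>\<sigma>\<in>{\<sigma>\<in>perms N. restrict \<sigma> {..<L} = \<iota>}. h (restrict \<sigma> {..<L}))
        = of_nat (card {\<sigma>\<in>perms N. restrict \<sigma> {..<L} = \<iota>}) * h \<iota>"
      by simp
    also have "\<dots> = fact (N - L) * h \<iota>"
      using card_permutations_extending[OF \<iota> _ assms(1)] h0[of \<iota>]
      by (cases "inj_on \<iota> {..<L}") auto
    finally show "(\<Sum>\<sigma>\<in>{\<sigma>\<in>perms N. restrict \<sigma> {..<L} = \<iota>}. h (restrict \<sigma> {..<L}))
        = fact (N - L) * h \<iota>" .
  qed
  finally show ?thesis
    by (simp add: sum_distrib_left)
qed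

lemma sum_perms_sign_cancel:
  fixes f :: "(nat \<Rightarrow> nat) \<Rightarrow> 'a::comm_ring_1"
  shows "(\<Sum>\<sigma>\<in>perms n. of_int (sign \<sigma>) * (of_int (sign \<sigma>) * c)) = fact n * c"
proof -
  have "of_int (sign \<sigma>) * (of_int (sign \<sigma>) * c) = c" for \<sigma> :: "nat \<Rightarrow> nat"
    by (simp add: sign_def)
  then show ?thesis by (simp add: card_permutations)
qed

subsection \<open>Interpolation and the Cauchy determinant\<close>

lemma lagrange_partial_fraction:
  fixes x :: "nat \<Rightarrow> 'a::field"
  assumes x: "inj_on x {..<N}" and y: "\<And>n. n < N \<Longrightarrow> y \<noteq> x n" and p: "degree p < N"
  shows "(\<Sum>i<N. poly p (x i) / (\<Prod>m\<in>{..<N} - {i}. x i - x m) / (y - x i))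
       = poly p y / (\<Prod>n<N. y - x n)"
proof -
  define B where "B = (\<lambda>i. \<Prod>m\<in>{..<N} - {i}. [:- x m, 1:])"
  define c where "c = (\<lambda>i. \<Prod>m\<in>{..<N} - {i}. x i - x m)"
  define q where "q = (\<Sum>i<N. Polynomial.smult (poly p (x i) / c i) (B i))"
  have c: "c i \<noteq> 0" if "i < N" for i
    using x that by (auto simp: c_def inj_on_def)
  have "degree (B i) = card ({..<N} - {i})" for i
    unfolding B_def by (subst degree_prod_eq_sum_degree) auto
  then have "degree (Polynomial.smult (poly p (x i) / c i) (B i)) < N" if "i < N" for i
    using that by (intro le_less_trans[OF degree_smult_le]) auto
  then have "degree q < N"
    unfolding q_def using p by (intro degree_sum_less) auto
  moreover have "poly q (x j) = poly p (x j)" if j: "j < N" for j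
  proof -
    have "poly (B i) (x j) = (if i = j then c j else 0)" if "i < N" for i
      using that j by (auto simp: B_def c_def poly_prod)
    then have "poly q (x j) = (\<Sum>i<N. if i = j then poly p (x j) else 0)"
      unfolding q_def poly_sum using c by (intro sum.cong) auto
    then show ?thesis using j by simp
  qed
  ultimately have "p = q"
    using p card_image[OF x] by (intro poly_eqI_degree[of "x ` {..<N}"]) auto
  have "poly (B i) y / (\<Prod>n<N. y - x n) = 1 / (y - x i)" if "i < N" for i
  proof -
    have "(\<Prod>n<N. y - x n) = (y - x i) * poly (B i) y"
      unfolding B_def poly_prod using that by (subst prod.remove[of _ i]) auto
    moreover have "poly (B i) y \<noteq> 0"
      using y by (auto simp: B_def poly_prod)
    ultimately show ?thesis by simp
  qed
  then have "(\<Sum>i<N. poly p (x i) / c i / (y - x i))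
      = (\<Sum>i<N. poly p (x i) / c i * (poly (B i) y / (\<Prod>n<N. y - x n)))"
    by (intro sum.cong) auto
  also have "\<dots> = poly q y / (\<Prod>n<N. y - x n)"
    unfolding q_def poly_sum sum_divide_distrib by (intro sum.cong) auto
  finally show ?thesis
    unfolding c_def using \<open>p = q\<close> by simp
qed

text \<open>Expanding the Vandermonde factor over permutations separates the variables, so that the
  sum over all index maps becomes a product of single sums. It serves interpolation in several
  variables and sums of residues alike.\<close>

lemma sum_PiE_vandermonde_prod:
  fixes x :: "nat \<Rightarrow> 'a::idom"
  shows "(\<Sum>\<iota>\<in>{..<L} \<rightarrow>\<^sub>E {..<N}. vandermonde L (\<lambda>l. x (\<iota> l)) * (\<Prod>l<L. r l (\<iota> l)))
    = (\<Sum>\<tau>\<in>perms L. of_int (sign \<tau>) * (\<Prod>l<L. \<Sum>n<N. x n ^ (L - 1 - \<tau> l) * r l n))"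
proof -
  have "(\<Sum>\<tau>\<in>perms L. of_int (sign \<tau>) * (\<Prod>l<L. \<Sum>n<N. x n ^ (L - 1 - \<tau> l) * r l n))
      = (\<Sum>\<tau>\<in>perms L. \<Sum>\<iota>\<in>{..<L} \<rightarrow>\<^sub>E {..<N}.
          of_int (sign \<tau>) * (\<Prod>l<L. x (\<iota> l) ^ (L - 1 - \<tau> l) * r l (\<iota> l)))"
    by (simp add: prod_sum_PiE sum_distrib_left)
  also have "\<dots> = (\<Sum>\<iota>\<in>{..<L} \<rightarrow>\<^sub>E {..<N}. \<Sum>\<tau>\<in>perms L.
          of_int (sign \<tau>) * (\<Prod>l<L. x (\<iota> l) ^ (L - 1 - \<tau> l) * r l (\<iota> l)))"
    by (rule sum.swap)
  also have "\<dots> = (\<Sum>\<iota>\<in>{..<L} \<rightarrow>\<^sub>E {..<N}. vandermonde L (\<lambda>l. x (\<iota> l)) * (\<Prod>l<L. r l (\<iota> l)))"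
    by (simp add: vandermonde_expand_powers sum_distrib_right prod.distrib mult.assoc)
  finally show ?thesis by simp
qed

lemma multi_lagrange:
  fixes x y :: "nat \<Rightarrow> 'a::field"
  assumes x: "inj_on x {..<N}" and y: "\<And>l n. l < L \<Longrightarrow> n < N \<Longrightarrow> y l \<noteq> x n"
    and y0: "\<And>l. l < L \<Longrightarrow> y l \<noteq> 0" and "L \<le> N"
  shows "(\<Sum>\<iota>\<in>{..<L} \<rightarrow>\<^sub>E {..<N}. vandermonde L (\<lambda>l. x (\<iota> l)) *
            (\<Prod>l<L. (x (\<iota> l) / y l) ^ (N - L) / (\<Prod>m\<in>{..<N} - {\<iota> l}. x (\<iota> l) - x m) / (y l - x (\<iota> l))))
       = vandermonde L y / (\<Prod>l<L. \<Prod>n<N. y l - x n)"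
proof -
  have "(\<Sum>n<N. x n ^ (L - 1 - \<tau> l) * ((x n / y l) ^ (N - L) / (\<Prod>m\<in>{..<N} - {n}. x n - x m) / (y l - x n)))
      = y l ^ (L - 1 - \<tau> l) / (\<Prod>n<N. y l - x n)" if \<tau>: "\<tau> \<in> perms L" and l: "l < L" for \<tau> l
  proof -
    define e where "e = L - 1 - \<tau> l"
    \<comment> \<open>Interpolation needs degree below \<open>N\<close>. As
      \<open>e \<le> L - 1\<close>, the extra power \<open>N - L\<close> is the largest that is
      admissible for all terms at once; the coefficient \<open>1 / y l ^ (N - L)\<close> removes it
      again at \<open>y l\<close>.\<close>
    have e: "N - L + e < N"
      using l assms(4) by (auto simp: e_def)
    have "(\<Sum>n<N. x n ^ e * ((x n / y l) ^ (N - L) / (\<Prod>m\<in>{..<N} - {n}. x n - x m) / (y l - x n)))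
        = (\<Sum>n<N. poly (monom (1 / y l ^ (N - L)) (N - L + e)) (x n) /
             (\<Prod>m\<in>{..<N} - {n}. x n - x m) / (y l - x n))"
      by (intro sum.cong) (auto simp: poly_monom power_divide power_add)
    also have "\<dots> = poly (monom (1 / y l ^ (N - L)) (N - L + e)) (y l) / (\<Prod>n<N. y l - x n)"
      using y[OF l] e by (intro lagrange_partial_fraction[OF x]) (auto intro: le_less_trans[OF degree_monom_le])
    also have "\<dots> = y l ^ e / (\<Prod>n<N. y l - x n)"
      using y0[OF l] by (simp add: poly_monom power_add)
    finally show ?thesis unfolding e_def .
  qed
  then have "(\<Sum>\<tau>\<in>perms L. of_int (sign \<tau>) * (\<Prod>l<L. \<Sum>n<N. x n ^ (L - 1 - \<tau> l) *
        ((x n / y l) ^ (N - L) / (\<Prod>m\<in>{..<N} - {n}. x n - x m) / (y l - x n))))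
      = (\<Sum>\<tau>\<in>perms L. of_int (sign \<tau>) * (\<Prod>l<L. y l ^ (L - 1 - \<tau> l) / (\<Prod>n<N. y l - x n)))"
    by (intro sum.cong arg_cong2[where f = "(*)"] prod.cong) auto
  also have "\<dots> = vandermonde L y / (\<Prod>l<L. \<Prod>n<N. y l - x n)"
    by (simp add: vandermonde_expand_powers prod_dividef sum_divide_distrib)
  finally show ?thesis
    by (subst sum_PiE_vandermonde_prod[where r = "\<lambda>l n. (x n / y l) ^ (N - L) / (\<Prod>m\<in>{..<N} - {n}. x n - x m) / (y l - x n)"])
qed

text \<open>The left side is the Leibniz expansion of the determinant of
  \<open>1 / (y l - u n)\<close>. The case \<open>N = L\<close> of \<open>multi_lagrange\<close> has
  no extra power; its sum over maps reduces to permutations, for which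
  \<open>vandermonde_partial_fraction\<close> with \<open>K = 0\<close> collapses the weights to a
  sign over \<open>vandermonde L u\<close>.\<close>

lemma cauchy_determinant:
  fixes u y :: "nat \<Rightarrow> 'a::field_char_0"
  assumes u: "inj_on u {..<L}" and y: "\<And>l n. l < L \<Longrightarrow> n < L \<Longrightarrow> y l \<noteq> u n"
    and y0: "\<And>l. l < L \<Longrightarrow> y l \<noteq> 0"
  shows "(\<Sum>\<tau>\<in>perms L. of_int (sign \<tau>) * (\<Prod>l<L. 1 / (y l - u (\<tau> l))))
       = (-1) ^ (L * (L - 1) div 2) * vandermonde L u * vandermonde L y / (\<Prod>l<L. \<Prod>n<L. y l - u n)"
proof -
  define e :: 'a where "e = (-1) ^ (L * (L - 1) div 2)"
  define h where "h = (\<lambda>\<iota>. vandermonde L (\<lambda>l. u (\<iota> l)) *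
    (\<Prod>l<L. (u (\<iota> l) / y l) ^ (L - L) / (\<Prod>m\<in>{..<L} - {\<iota> l}. u (\<iota> l) - u m) / (y l - u (\<iota> l))))"
  have nz: "vandermonde L u \<noteq> 0"
    by (rule vandermonde_neq_0[OF u])
  have e: "e * e = 1" "e \<noteq> 0"
    by (auto simp: e_def power_mult_distrib[symmetric])
  have "vandermonde L y / (\<Prod>l<L. \<Prod>n<L. y l - u n) = (\<Sum>\<iota>\<in>{..<L} \<rightarrow>\<^sub>E {..<L}. h \<iota>)"
    unfolding h_def by (rule multi_lagrange[OF u y y0, symmetric]) auto
  also have "\<dots> = (\<Sum>\<tau>\<in>perms L. h (restrict \<tau> {..<L}))"
  proof -
    have "h \<iota> = 0" if "\<not> inj_on \<iota> {..<L}" for \<iota>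
    proof -
      have "vandermonde L (\<lambda>l. u (\<iota> l)) = 0"
        using that by (auto simp: inj_on_def intro: vandermonde_eq_0)
      then show ?thesis by (simp add: h_def)
    qed
    then show ?thesis
      using sum_perms_eq_sum_injections[of L L h] by simp
  qed
  also have "\<dots> = (\<Sum>\<tau>\<in>perms L. e / vandermonde L u * (of_int (sign \<tau>) * (\<Prod>l<L. 1 / (y l - u (\<tau> l)))))"
  proof (rule sum.cong[OF refl])
    fix \<tau> assume \<tau>: "\<tau> \<in> perms L"
    have v: "vandermonde L (\<lambda>l. u (restrict \<tau> {..<L} l)) = vandermonde L (\<lambda>l. u (\<tau> l))"
      by (rule vandermonde_cong) auto
    have "h (restrict \<tau> {..<L}) = vandermonde L (\<lambda>l. u (\<tau> l)) *
        (\<Prod>l<L. 1 / (\<Prod>m\<in>{..<L} - {\<tau> l}. u (\<tau> l) - u m)) * (\<Prod>l<L. 1 / (y l - u (\<tau> l)))"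
      unfolding h_def v by (simp add: prod_dividef prod.distrib)
    also have "vandermonde L (\<lambda>l. u (\<tau> l)) * (\<Prod>l<L. 1 / (\<Prod>m\<in>{..<L} - {\<tau> l}. u (\<tau> l) - u m))
        = e * of_int (sign \<tau>) / vandermonde L u"
      using vandermonde_partial_fraction[of \<tau> L 0 u] \<tau> u
      by (simp add: e_def vandermonde_def[of 0])
    finally show "h (restrict \<tau> {..<L})
        = e / vandermonde L u * (of_int (sign \<tau>) * (\<Prod>l<L. 1 / (y l - u (\<tau> l))))"
      by (simp only: times_divide_eq_left times_divide_eq_right mult.assoc)
  qed
  finally have "vandermonde L y / (\<Prod>l<L. \<Prod>n<L. y l - u n)
      = e / vandermonde L u * (\<Sum>\<tau>\<in>perms L. of_int (sign \<tau>) * (\<Prod>l<L. 1 / (y l - u (\<tau> l))))"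
    by (simp add: sum_distrib_left)
  then have "e * vandermonde L u * (vandermonde L y / (\<Prod>l<L. \<Prod>n<L. y l - u n))
      = e * e * (\<Sum>\<tau>\<in>perms L. of_int (sign \<tau>) * (\<Prod>l<L. 1 / (y l - u (\<tau> l))))"
    using nz by simp
  then show ?thesis
    by (simp add: e e_def[symmetric] mult.assoc del: One_nat_def)
qed

text \<open>Interpolation alone pairs each \<open>y l\<close> with the single point
  \<open>x (\<sigma> l)\<close>, whereas the integrand of the theorem has all pairs in its
  denominator; Cauchy's determinant bridges the two. \<open>fact K\<close> counts the permutations
  with given first \<open>L\<close> values, \<open>fact L\<close> the orders of the selected
  points.\<close>

lemma vandermonde_div_prod:
  fixes x y :: "nat \<Rightarrow> 'a::field_char_0"
  assumes x: "inj_on x {..<L + K}" and y: "\<And>l n. l < L \<Longrightarrow> n < L + K \<Longrightarrow> y l \<noteq> x n"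
    and y0: "\<And>l. l < L \<Longrightarrow> y l \<noteq> 0" and yinj: "inj_on y {..<L}"
  shows "fact L * fact K * (vandermonde (L + K) x / (\<Prod>l<L. \<Prod>n<L + K. y l - x n))
    = (\<Sum>\<sigma>\<in>perms (L + K). of_int (sign \<sigma>) * (vandermonde L (\<lambda>l. x (\<sigma> l)) *
         vandermonde K (\<lambda>n. x (\<sigma> (L + n))) *
         (\<Prod>l<L. (x (\<sigma> l) / y l) ^ K / (\<Prod>j<L. y j - x (\<sigma> l)))))"
proof -
  define N where "N = L + K"
  have N: "L \<le> N" "N - L = K" by (auto simp: N_def)
  define e :: 'a where "e = (-1) ^ (L * (L - 1) div 2)"
  have e: "e * e = 1"
    by (auto simp: e_def power_mult_distrib[symmetric])
  have ynz: "vandermonde L y \<noteq> 0"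
    by (rule vandermonde_neq_0[OF yinj])
  have xnz: "vandermonde N x \<noteq> 0"
    by (rule vandermonde_neq_0) (use x N_def in simp)
  define c where "c = (\<lambda>i. \<Prod>m\<in>{..<N} - {i}. x i - x m)"
  define h where "h = (\<lambda>\<iota>. vandermonde L (\<lambda>l. x (\<iota> l)) *
    (\<Prod>l<L. (x (\<iota> l) / y l) ^ (N - L) / c (\<iota> l) / (y l - x (\<iota> l))))"
  let ?D = "vandermonde L y / (\<Prod>l<L. \<Prod>n<N. y l - x n)"
  have "?D = (\<Sum>\<iota>\<in>{..<L} \<rightarrow>\<^sub>E {..<N}. h \<iota>)"
    unfolding h_def c_def using x y y0 N
    by (intro multi_lagrange[symmetric]) (auto simp: N_def)
  moreover have "h \<iota> = 0" if "\<not> inj_on \<iota> {..<L}" for \<iota>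
  proof -
    have "vandermonde L (\<lambda>l. x (\<iota> l)) = 0"
      using that by (auto simp: inj_on_def intro: vandermonde_eq_0)
    then show ?thesis by (simp add: h_def)
  qed
  ultimately have D: "fact K * ?D = (\<Sum>\<sigma>\<in>perms N. h (restrict \<sigma> {..<L}))"
    using sum_perms_eq_sum_injections[OF N(1), of h] N(2) by simp
  text \<open>The summand depends on \<open>\<sigma>\<close> up to a permutation of \<open>{..<L}\<close> only through
    \<open>\<Prod> 1 / (y\<^sub>l - x\<^bsub>\<sigma> l\<^esub>)\<close> and the sign; averaging over these permutations produces the
    Cauchy determinant.\<close>
  define T where "T = (\<lambda>\<sigma>. vandermonde L (\<lambda>l. x (\<sigma> l)) * (\<Prod>l<L. (x (\<sigma> l) / y l) ^ K) * (\<Prod>l<L. 1 / c (\<sigma> l)))"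
  have h: "h (restrict \<sigma> {..<L}) = T \<sigma> * (\<Prod>l<L. 1 / (y l - x (\<sigma> l)))" for \<sigma>
  proof -
    have v: "vandermonde L (\<lambda>l. x (restrict \<sigma> {..<L} l)) = vandermonde L (\<lambda>l. x (\<sigma> l))"
      by (rule vandermonde_cong) auto
    show ?thesis
      unfolding h_def v T_def by (simp add: prod_dividef prod.distrib N)
  qed
  have T: "T (\<sigma> \<circ> \<tau>) = of_int (sign \<tau>) * T \<sigma>" if \<tau>: "\<tau> \<in> perms L" for \<sigma> \<tau>
  proof -
    have p: "\<tau> permutes {..<L}" using \<tau> by simp
    have "vandermonde L (\<lambda>l. x (\<sigma> (\<tau> l))) = of_int (sign \<tau>) * vandermonde L (\<lambda>l. x (\<sigma> l))"
      by (rule vandermonde_perm[OF \<tau>, of "\<lambda>l. x (\<sigma> l)"])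
    moreover have "(\<Prod>l<L. x (\<sigma> (\<tau> l)) ^ K) = (\<Prod>l<L. x (\<sigma> l) ^ K)"
      "(\<Prod>l<L. c (\<sigma> (\<tau> l))) = (\<Prod>l<L. c (\<sigma> l))"
      using prod.permute[OF p, of "\<lambda>l. x (\<sigma> l) ^ K"] prod.permute[OF p, of "\<lambda>l. c (\<sigma> l)"]
      by (simp_all add: o_def)
    ultimately show ?thesis
      unfolding T_def by (simp add: prod_dividef power_divide)
  qed
  have "fact L * (fact K * ?D) = (\<Sum>\<tau>\<in>perms L. \<Sum>\<sigma>\<in>perms N. h (restrict \<sigma> {..<L}))"
    unfolding D by (simp add: card_permutations)
  also have "\<dots> = (\<Sum>\<tau>\<in>perms L. \<Sum>\<sigma>\<in>perms N. T (\<sigma> \<circ> \<tau>) * (\<Prod>l<L. 1 / (y l - x (\<sigma> (\<tau> l)))))"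
  proof (rule sum.cong[OF refl])
    fix \<tau> assume "\<tau> \<in> perms L"
    then have "\<tau> permutes {..<N}"
      using N by (auto elim!: permutes_subset)
    then show "(\<Sum>\<sigma>\<in>perms N. h (restrict \<sigma> {..<L}))
        = (\<Sum>\<sigma>\<in>perms N. T (\<sigma> \<circ> \<tau>) * (\<Prod>l<L. 1 / (y l - x (\<sigma> (\<tau> l)))))"
      unfolding h by (subst sum_permutations_compose_right) (auto simp: o_def)
  qed
  also have "\<dots> = (\<Sum>\<tau>\<in>perms L. \<Sum>\<sigma>\<in>perms N.
      T \<sigma> * (of_int (sign \<tau>) * (\<Prod>l<L. 1 / (y l - x (\<sigma> (\<tau> l))))))"
    using T by (intro sum.cong) auto
  also have "\<dots> = (\<Sum>\<sigma>\<in>perms N. T \<sigma> *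
      (\<Sum>\<tau>\<in>perms L. of_int (sign \<tau>) * (\<Prod>l<L. 1 / (y l - x (\<sigma> (\<tau> l))))))"
    by (subst sum.swap) (simp add: sum_distrib_left)
  also have "\<dots> = (\<Sum>\<sigma>\<in>perms N. vandermonde L y / vandermonde N x *
      (of_int (sign \<sigma>) * (vandermonde L (\<lambda>l. x (\<sigma> l)) * vandermonde K (\<lambda>n. x (\<sigma> (L + n))) *
         (\<Prod>l<L. (x (\<sigma> l) / y l) ^ K / (\<Prod>j<L. y j - x (\<sigma> l))))))"
  proof (rule sum.cong[OF refl])
    fix \<sigma> assume \<sigma>: "\<sigma> \<in> perms N"
    then have p: "\<sigma> permutes {..<N}" by simp
    have lt: "\<sigma> l < N" if "l < N" for l
      using permutes_in_image[OF p, of l] that by simp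
    have "inj_on (\<lambda>l. x (\<sigma> l)) {..<L}"
      using comp_inj_on[OF permutes_inj_on[OF p, of "{..<N}"], of x] x permutes_image[OF p] N
      by (auto simp: N_def[symmetric] o_def elim: inj_on_subset)
    then have C: "(\<Sum>\<tau>\<in>perms L. of_int (sign \<tau>) * (\<Prod>l<L. 1 / (y l - x (\<sigma> (\<tau> l)))))
        = e * vandermonde L (\<lambda>l. x (\<sigma> l)) * vandermonde L y / (\<Prod>l<L. \<Prod>n<L. y l - x (\<sigma> n))"
      unfolding e_def using y y0 lt N
      by (intro cauchy_determinant) (auto simp: N_def[symmetric])
    have P: "vandermonde L (\<lambda>l. x (\<sigma> l)) * (\<Prod>l<L. 1 / c (\<sigma> l))
        = e * of_int (sign \<sigma>) * vandermonde K (\<lambda>n. x (\<sigma> (L + n))) / vandermonde N x"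
      unfolding e_def c_def N_def
      by (rule vandermonde_partial_fraction) (use \<sigma> x in \<open>auto simp: N_def\<close>)
    have S: "(\<Prod>l<L. (x (\<sigma> l) / y l) ^ K / (\<Prod>j<L. y j - x (\<sigma> l)))
        = (\<Prod>l<L. (x (\<sigma> l) / y l) ^ K) / (\<Prod>l<L. \<Prod>n<L. y l - x (\<sigma> n))"
      using prod.swap[of "\<lambda>l n. y l - x (\<sigma> n)" "{..<L}" "{..<L}"] by (simp add: prod_dividef)
    have "T \<sigma> * (\<Sum>\<tau>\<in>perms L. of_int (sign \<tau>) * (\<Prod>l<L. 1 / (y l - x (\<sigma> (\<tau> l)))))
       = (vandermonde L (\<lambda>l. x (\<sigma> l)) * (\<Prod>l<L. 1 / c (\<sigma> l))) * (\<Prod>l<L. (x (\<sigma> l) / y l) ^ K) *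
         (e * vandermonde L (\<lambda>l. x (\<sigma> l)) * vandermonde L y / (\<Prod>l<L. \<Prod>n<L. y l - x (\<sigma> n)))"
      unfolding T_def C by (simp only: mult_ac)
    \<comment> \<open>The sign from Cauchy's determinant and the sign from the partial fractions
      meet in \<open>e * e\<close> and cancel.\<close>
    also have "\<dots> = (e * e) * (vandermonde L y / vandermonde N x *
      (of_int (sign \<sigma>) * (vandermonde L (\<lambda>l. x (\<sigma> l)) * vandermonde K (\<lambda>n. x (\<sigma> (L + n))) *
         ((\<Prod>l<L. (x (\<sigma> l) / y l) ^ K) / (\<Prod>l<L. \<Prod>n<L. y l - x (\<sigma> n))))))"
      unfolding P by (simp add: mult_ac)
    finally show "T \<sigma> * (\<Sum>\<tau>\<in>perms L. of_int (sign \<tau>) * (\<Prod>l<L. 1 / (y l - x (\<sigma> (\<tau> l)))))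
      = vandermonde L y / vandermonde N x *
      (of_int (sign \<sigma>) * (vandermonde L (\<lambda>l. x (\<sigma> l)) * vandermonde K (\<lambda>n. x (\<sigma> (L + n))) *
         (\<Prod>l<L. (x (\<sigma> l) / y l) ^ K / (\<Prod>j<L. y j - x (\<sigma> l)))))"
      unfolding S by (simp add: e)
  qed
  finally have "fact L * (fact K * ?D) = vandermonde L y / vandermonde N x *
    (\<Sum>\<sigma>\<in>perms N. of_int (sign \<sigma>) * (vandermonde L (\<lambda>l. x (\<sigma> l)) * vandermonde K (\<lambda>n. x (\<sigma> (L + n))) *
         (\<Prod>l<L. (x (\<sigma> l) / y l) ^ K / (\<Prod>j<L. y j - x (\<sigma> l)))))"
    by (simp add: sum_distrib_left)
  then have "vandermonde N x / vandermonde L y * (fact L * (fact K * ?D)) =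
    (\<Sum>\<sigma>\<in>perms N. of_int (sign \<sigma>) * (vandermonde L (\<lambda>l. x (\<sigma> l)) * vandermonde K (\<lambda>n. x (\<sigma> (L + n))) *
         (\<Prod>l<L. (x (\<sigma> l) / y l) ^ K / (\<Prod>j<L. y j - x (\<sigma> l)))))"
    using xnz ynz by simp
  then show ?thesis
    using ynz by (simp add: N_def mult_ac)
qed

subsection \<open>Nested integrals\<close>

text \<open>If each \<open>T j\<close> sees its argument only on \<open>S\<close>, only points with
  all coordinates in \<open>S\<close> matter. This is applied with \<open>S\<close> the interval for
  the \<open>v\<close>, and with \<open>S\<close> the contour minus the parameters for the
  \<open>s\<close>.\<close>

lemma nested_integral_cong:
  assumes T: "\<And>j f g. j < n \<Longrightarrow> (\<And>t. t \<in> S \<Longrightarrow> f t = g t) \<Longrightarrow> T j f = T j g"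
    and fg: "\<And>w. (\<And>j. j < n \<Longrightarrow> w j \<in> S) \<Longrightarrow> f w = g w"
  shows "nested_integral T n f = nested_integral T n g"
  using assms
proof (induction n arbitrary: f g)
  case (Suc n)
  have "nested_integral T n (\<lambda>w. T n (\<lambda>t. f (w(n := t)))) = nested_integral T n (\<lambda>w. T n (\<lambda>t. g (w(n := t))))"
  proof (rule Suc.IH)
    fix w :: "nat \<Rightarrow> 'a" assume w: "\<And>j. j < n \<Longrightarrow> w j \<in> S"
    show "T n (\<lambda>t. f (w(n := t))) = T n (\<lambda>t. g (w(n := t)))"
    proof (rule Suc.prems(1)[OF lessI])
      fix t assume "t \<in> S"
      then show "f (w(n := t)) = g (w(n := t))"
        using w by (intro Suc.prems(2)) (auto simp: less_Suc_eq)
    qed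
  qed (rule Suc.prems(1)[OF less_SucI])
  then show ?case by simp
qed simp

text \<open>Nested integration of a finite sum of products acts factor by factor. Linearity of
  \<open>T j\<close> is asked only for the given functions, so that nothing is claimed about
  non-integrable ones, and for arbitrary \<open>c\<close>, because the factors in the outer
  variables enter the inner integral as coefficients.\<close>

lemma nested_integral_sum_prod:
  assumes "finite A"
    and T: "\<And>j c. j < n \<Longrightarrow> T j (\<lambda>t. \<Sum>\<alpha>\<in>A. c \<alpha> * h \<alpha> j t) = (\<Sum>\<alpha>\<in>A. c \<alpha> * T' \<alpha> j)"
  shows "nested_integral T n (\<lambda>w. \<Sum>\<alpha>\<in>A. c \<alpha> * (\<Prod>j<n. h \<alpha> j (w j)))
       = (\<Sum>\<alpha>\<in>A. c \<alpha> * (\<Prod>j<n. T' \<alpha> j))"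
  using T
proof (induction n arbitrary: c)
  case (Suc n)
  have "(\<Prod>j<Suc n. h \<alpha> j ((w(n := t)) j)) = (\<Prod>j<n. h \<alpha> j (w j)) * h \<alpha> n t" for \<alpha> w t
    by (simp add: prod.cong[of "{..<n}" "{..<n}" "\<lambda>j. h \<alpha> j (if j = n then t else w j)"])
  then have "nested_integral T (Suc n) (\<lambda>w. \<Sum>\<alpha>\<in>A. c \<alpha> * (\<Prod>j<Suc n. h \<alpha> j (w j)))
      = nested_integral T n (\<lambda>w. T n (\<lambda>t. \<Sum>\<alpha>\<in>A. (c \<alpha> * (\<Prod>j<n. h \<alpha> j (w j))) * h \<alpha> n t))"
    by (simp add: mult.assoc del: prod.lessThan_Suc)
  also have "\<dots> = nested_integral T n (\<lambda>w. \<Sum>\<alpha>\<in>A. c \<alpha> * (\<Prod>j<n. h \<alpha> j (w j)) * T' \<alpha> n)"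
    by (subst Suc.prems) auto
  also have "\<dots> = nested_integral T n (\<lambda>w. \<Sum>\<alpha>\<in>A. (c \<alpha> * T' \<alpha> n) * (\<Prod>j<n. h \<alpha> j (w j)))"
    by (simp only: mult_ac)
  also have "\<dots> = (\<Sum>\<alpha>\<in>A. (c \<alpha> * T' \<alpha> n) * (\<Prod>j<n. T' \<alpha> j))"
    by (rule Suc.IH) (use Suc.prems in auto)
  also have "\<dots> = (\<Sum>\<alpha>\<in>A. c \<alpha> * (\<Prod>j<Suc n. T' \<alpha> j))"
    by (simp add: mult_ac)
  finally show ?case .
qed simp

subsection \<open>Contour integrals and product measures\<close>

text \<open>A curve passes through a point with non-zero velocity only at isolated times, and a set
  of isolated points of the real line is countable: each has a basic neighbourhood that meets the
  set in it alone.\<close>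

lemma countable_preimage_nonzero_derivative:
  fixes \<gamma> :: "real \<Rightarrow> 'a::real_normed_vector"
  shows "countable {t. \<gamma> t = p \<and> (\<exists>D. D \<noteq> 0 \<and> (\<gamma> has_vector_derivative D) (at t))}" (is "countable ?X")
proof -
  define X where "X = ?X"
  have isol: "\<not> t islimpt X" if t: "t \<in> X" for t
  proof
    assume lim: "t islimpt X"
    obtain D where D: "D \<noteq> 0" "(\<gamma> has_vector_derivative D) (at t)" "\<gamma> t = p"
      using t by (auto simp: X_def)
    have "((\<lambda>s. norm (\<gamma> s - \<gamma> t - (s - t) *\<^sub>R D) / norm (s - t)) \<longlongrightarrow> 0) (at t)"
      using D(2) by (simp add: has_vector_derivative_def has_derivative_iff_norm)
    moreover have "0 < norm D" using D by simp
    ultimately have "eventually (\<lambda>s. norm (\<gamma> s - \<gamma> t - (s - t) *\<^sub>R D) / norm (s - t) < norm D) (at t)"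
      by (rule order_tendstoD)
    moreover have "eventually (\<lambda>s. s \<noteq> t) (at t)"
      by (rule eventually_neq_at_within)
    ultimately have "eventually (\<lambda>s. s \<notin> X) (at t)"
    proof eventually_elim
      case (elim s)
      show ?case
      proof
        assume "s \<in> X"
        \<comment> \<open>For equal values the quotient is exactly \<open>norm D\<close>, which the
          strict bound excludes.\<close>
        then have "\<gamma> s = \<gamma> t" using D by (simp add: X_def)
        with elim show False by simp
      qed
    qed
    with lim show False
      by (simp add: islimpt_conv_frequently_at frequently_def)
  qed
  have isolated: "\<exists>V. open V \<and> t \<in> V \<and> V \<inter> X = {t}" if t: "t \<in> X" for t
  proof -
    obtain V where "open V" "t \<in> V" "\<forall>y\<in>X. y \<in> V \<longrightarrow> y = t"
      using isol[OF t] unfolding islimpt_def by blast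
    with t show ?thesis
      by blast
  qed
  obtain B :: "real set set" where B: "countable B" "topological_basis B"
    using ex_countable_basis by blast
  have "X \<subseteq> (\<lambda>b. the_elem (b \<inter> X)) ` B"
  proof
    fix t assume t: "t \<in> X"
    then obtain V where V: "open V" "t \<in> V" "V \<inter> X = {t}"
      using isolated by blast
    then obtain b where b: "b \<in> B" "t \<in> b" "b \<subseteq> V"
      using topological_basisE[OF B(2)] by blast
    then have "b \<inter> X = {t}"
      using V t by blast
    then have "t = the_elem (b \<inter> X)"
      by simp
    with b(1) show "t \<in> (\<lambda>b. the_elem (b \<inter> X)) ` B"
      by blast
  qed
  then show ?thesis
    unfolding X_def[symmetric] using B(1) by (meson countable_image countable_subset)
qed

lemma countable_negligible:
  fixes X :: "real set"
  assumes "countable X"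
  shows "negligible X"
  using null_sets_completionI[OF countable_imp_null_set_lborel[OF assms]]
  by (simp add: negligible_iff_null_sets)

text \<open>\<open>contour_on\<close> gives finitely many exceptional times on compact subintervals
  only. Countably many such intervals with rational endpoints cover the interior of
  \<open>J\<close>, and the rest of \<open>J\<close> lies in the frontier of a convex set.\<close>

lemma negligible_contour_on_nondifferentiable:
  assumes "contour_on J \<gamma>"
  shows "negligible {t\<in>J. \<not> (\<exists>D. (\<gamma> has_vector_derivative D) (at t))}" (is "negligible ?X")
proof -
  let ?Q = "{(a, b). a \<in> \<rat> \<and> b \<in> \<rat> \<and> {a..b} \<subseteq> J}"
  have "J - interior J \<subseteq> frontier J"
    unfolding frontier_def using closure_subset by blast
  then have fr: "negligible (J - interior J)"
    using negligible_convex_frontier[of J] assms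
    by (auto simp: contour_on_def is_interval_convex intro: negligible_subset)
  have sub: "?X \<subseteq> (J - interior J) \<union> (\<Union>(a, b)\<in>?Q. {t\<in>{a..b}. \<not> (\<exists>D. (\<gamma> has_vector_derivative D) (at t))})"
  proof
    fix t assume t: "t \<in> ?X"
    show "t \<in> (J - interior J) \<union> (\<Union>(a, b)\<in>?Q. {t\<in>{a..b}. \<not> (\<exists>D. (\<gamma> has_vector_derivative D) (at t))})"
    proof (cases "t \<in> interior J")
      case True
      then obtain e where e: "e > 0" "cball t e \<subseteq> J"
        by (meson mem_interior_cball)
      obtain a b where "a \<in> \<rat>" "t - e < a" "a < t" "b \<in> \<rat>" "t < b" "b < t + e"
        using Rats_dense_in_real[of "t - e" t] Rats_dense_in_real[of t "t + e"] e by auto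
      then have "(a, b) \<in> ?Q" "t \<in> {a..b}"
        using e by (auto simp: cball_eq_atLeastAtMost)
      then show ?thesis using t by blast
    qed (use t in auto)
  qed
  have "finite {t\<in>{a..b}. \<not> (\<exists>D. (\<gamma> has_vector_derivative D) (at t))}" if ab: "{a..b} \<subseteq> J" for a b
  proof -
    have "\<gamma> piecewise_C1_differentiable_on {a..b}"
      using assms ab by (simp add: contour_on_def)
    then obtain S where "finite S" "\<gamma> C1_differentiable_on ({a..b} - S)"
      by (auto simp: piecewise_C1_differentiable_on_def)
    then have "{t\<in>{a..b}. \<not> (\<exists>D. (\<gamma> has_vector_derivative D) (at t))} \<subseteq> S"
      unfolding C1_differentiable_on_def by blast
    with \<open>finite S\<close> show ?thesis
      by (rule finite_subset[rotated])
  qed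
  moreover have "countable ?Q"
  proof (rule countable_subset)
    show "?Q \<subseteq> \<rat> \<times> \<rat>" by auto
  qed (simp add: countable_rat)
  ultimately have "negligible (\<Union>(a, b)\<in>?Q. {t\<in>{a..b}. \<not> (\<exists>D. (\<gamma> has_vector_derivative D) (at t))})"
    by (intro negligible_countable_Union countable_image) (auto intro: negligible_finite)
  with fr sub show ?thesis
    by (meson negligible_Un negligible_subset)
qed

text \<open>A contour may run through a point of a finite set for a positive amount of time, but only with
  velocity zero.\<close>

lemma negligible_contour_on_hits:
  assumes "contour_on J \<gamma>" "finite A"
  shows "negligible {t\<in>J. \<gamma> t \<in> A \<and> vector_derivative \<gamma> (at t) \<noteq> 0}"
proof (rule negligible_subset)
  show "negligible ({t\<in>J. \<not> (\<exists>D. (\<gamma> has_vector_derivative D) (at t))}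
    \<union> (\<Union>p\<in>A. {t. \<gamma> t = p \<and> (\<exists>D. D \<noteq> 0 \<and> (\<gamma> has_vector_derivative D) (at t))}))"
    using assms countable_preimage_nonzero_derivative
    by (intro negligible_Un negligible_contour_on_nondifferentiable countable_negligible[OF countable_UN])
      (auto intro: countable_finite)
  show "{t\<in>J. \<gamma> t \<in> A \<and> vector_derivative \<gamma> (at t) \<noteq> 0} \<subseteq>
    {t\<in>J. \<not> (\<exists>D. (\<gamma> has_vector_derivative D) (at t))}
    \<union> (\<Union>p\<in>A. {t. \<gamma> t = p \<and> (\<exists>D. D \<noteq> 0 \<and> (\<gamma> has_vector_derivative D) (at t))})"
    by (auto dest: vector_derivative_at)
qed

text \<open>At a point of \<open>A\<close> either the velocity is zero, and both integrands vanish,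
  or the time belongs to a negligible set. This permits the contour of (ii) to run through
  parameters \<open>a n\<close>, where the integrands involve division by zero.\<close>

lemma has_integral_along_off_finite:
  assumes "has_integral_along f i J \<gamma>" "contour_on J \<gamma>" "finite A"
    and "\<And>s. s \<in> \<gamma> ` J - A \<Longrightarrow> g s = f s"
  shows "has_integral_along g i J \<gamma>"
  unfolding has_integral_along_def
proof (rule has_integral_spike[OF negligible_contour_on_hits[OF assms(2,3)]])
  fix t assume "t \<in> J - {t\<in>J. \<gamma> t \<in> A \<and> vector_derivative \<gamma> (at t) \<noteq> 0}"
  then show "g (\<gamma> t) * vector_derivative \<gamma> (at t) = f (\<gamma> t) * vector_derivative \<gamma> (at t)"
    using assms(4)[of "\<gamma> t"] by (cases "\<gamma> t \<in> A") auto
qed (use assms(1) in \<open>simp add: has_integral_along_def\<close>)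

text \<open>The residue theorem with simple poles at the \<open>a n\<close>. \<open>S\<close>
  collects the other singularities of \<open>g\<close>, later the points \<open>s j\<close>; the
  contour does not wind around them, so they drop out.\<close>

lemma contour_integral_partial_fraction:
  fixes a :: "nat \<Rightarrow> complex"
  assumes U: "open U" "connected U" and a: "inj_on a {..<N}" "a ` {..<N} \<subseteq> U"
    and c: "encircles U (a ` {..<N}) c"
    and S: "finite S" "S \<inter> a ` {..<N} = {}" "\<And>s. s \<in> S \<Longrightarrow> s \<notin> path_image c \<and> winding_number c s = 0"
    and g: "g holomorphic_on U - S"
  shows "1 / (2 * of_real pi * \<i>) * contour_integral c (\<lambda>t. g t / (\<Prod>n<N. t - a n))
       = (\<Sum>n<N. g (a n) / (\<Prod>m\<in>{..<N} - {n}. a n - a m))"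
proof -
  let ?A = "a ` {..<N}"
  let ?f = "\<lambda>t. g t / (\<Prod>n<N. t - a n)"
  have res: "residue ?f (a n) = g (a n) / (\<Prod>m\<in>{..<N} - {n}. a n - a m)" if n: "n < N" for n
  proof -
    let ?h = "\<lambda>t. g t / (\<Prod>m\<in>{..<N} - {n}. t - a m)"
    have "?f = (\<lambda>t. ?h t / (t - a n))"
      using n by (simp add: prod.remove[of "{..<N}" n] mult.commute)
    moreover have "residue (\<lambda>t. ?h t / (t - a n)) (a n) = ?h (a n)"
    proof (rule residue_simple)
      show "open (U - S - a ` ({..<N} - {n}))"
        using U S by (intro open_Diff finite_imp_closed) auto
      show "a n \<in> U - S - a ` ({..<N} - {n})"
        using n a S(2) by (auto simp: inj_on_def)
      show "?h holomorphic_on U - S - a ` ({..<N} - {n})"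
        by (intro holomorphic_intros holomorphic_on_subset[OF g]) auto
    qed
    ultimately show ?thesis by simp
  qed
  have "contour_integral c ?f = 2 * pi * \<i> * (\<Sum>p\<in>?A \<union> S. winding_number c p * residue ?f p)"
  proof (rule Residue_theorem[OF U])
    show "?f holomorphic_on U - (?A \<union> S)"
      by (intro holomorphic_intros holomorphic_on_subset[OF g]) auto
  qed (use c S in \<open>auto simp: encircles_def\<close>)
  also have "(\<Sum>p\<in>?A \<union> S. winding_number c p * residue ?f p) = (\<Sum>p\<in>?A. residue ?f p)"
    using c S by (intro sum.mono_neutral_cong_right) (auto simp: encircles_def)
  also have "\<dots> = (\<Sum>n<N. g (a n) / (\<Prod>m\<in>{..<N} - {n}. a n - a m))"
    using res by (simp add: sum.reindex[OF a(1)])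
  finally show ?thesis
    by simp
qed

lemma sum_product_triple:
  fixes f :: "'a \<Rightarrow> 'd::comm_semiring_1"
  shows "sum f A * sum g B * sum k C = (\<Sum>(a, b, c)\<in>A \<times> B \<times> C. f a * (g b * k c))"
proof -
  have gk: "sum g B * sum k C = (\<Sum>(b, c)\<in>B \<times> C. g b * k c)"
    by (simp only: sum_product sum.cartesian_product)
  have "sum f A * (sum g B * sum k C) = (\<Sum>a\<in>A. f a * (\<Sum>(b, c)\<in>B \<times> C. g b * k c))"
    unfolding gk by (rule sum_distrib_right)
  also have "\<dots> = (\<Sum>a\<in>A. \<Sum>(b, c)\<in>B \<times> C. f a * (g b * k c))"
    by (simp only: sum_distrib_left split_def)
  finally show ?thesis
    by (simp add: sum.cartesian_product mult.assoc split_def)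
qed

text \<open>Fubini for finite sums of products. Reindexing moves the permutation from the variables
  to the factors; after integration the factors are numbers and it disappears from their
  product.\<close>

lemma PiM_sum_prod:
  fixes h :: "'i \<Rightarrow> nat \<Rightarrow> 'b \<Rightarrow> complex"
  assumes B: "sigma_finite_measure B" and \<sigma>: "\<sigma> \<in> perms N"
    and h: "\<And>\<alpha> k. \<alpha> \<in> A \<Longrightarrow> k < N \<Longrightarrow> integrable B (h \<alpha> k)"
  shows integrable_PiM_sum_prod:
      "integrable (\<Pi>\<^sub>M n\<in>{..<N}. B) (\<lambda>x. \<Sum>\<alpha>\<in>A. c \<alpha> * (\<Prod>k<N. h \<alpha> k (x (\<sigma> k))))"
    and integral_PiM_sum_prod:
      "(LINT x|(\<Pi>\<^sub>M n\<in>{..<N}. B). (\<Sum>\<alpha>\<in>A. c \<alpha> * (\<Prod>k<N. h \<alpha> k (x (\<sigma> k)))))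
        = (\<Sum>\<alpha>\<in>A. c \<alpha> * (\<Prod>k<N. LINT t|B. h \<alpha> k t))"
proof -
  interpret product_sigma_finite "\<lambda>_::nat. B"
    using B by (simp add: product_sigma_finite_def)
  define i where "i = inv_into UNIV \<sigma>"
  have \<sigma>': "\<sigma> permutes {..<N}" and i: "i permutes {..<N}"
    using \<sigma> permutes_inv by (auto simp: i_def)
  have i\<sigma>: "i (\<sigma> k) = k" for k
    using permutes_inverses[OF \<sigma>'] by (simp add: i_def)
  have lt: "i k < N" if "k < N" for k
    using permutes_in_image[OF i, of k] that by simp
  have reindex: "(\<Prod>k<N. h \<alpha> k (x (\<sigma> k))) = (\<Prod>k<N. h \<alpha> (i k) (x k))" for \<alpha> x
    using prod.permute[OF \<sigma>', of "\<lambda>k. h \<alpha> (i k) (x k)"] by (simp add: o_def i\<sigma>)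
  have reindex': "(\<Prod>k<N. LINT t|B. h \<alpha> (i k) t) = (\<Prod>k<N. LINT t|B. h \<alpha> k t)" for \<alpha>
    using prod.permute[OF i, of "\<lambda>k. LINT t|B. h \<alpha> k t"] by (simp add: o_def)
  have int: "integrable (\<Pi>\<^sub>M n\<in>{..<N}. B) (\<lambda>x. \<Prod>k<N. h \<alpha> (i k) (x k))"
    and val: "(LINT x|(\<Pi>\<^sub>M n\<in>{..<N}. B). (\<Prod>k<N. h \<alpha> (i k) (x k))) = (\<Prod>k<N. LINT t|B. h \<alpha> (i k) t)"
    if "\<alpha> \<in> A" for \<alpha>
    using h[OF that] lt
    by (auto intro!: product_integrable_prod[of "{..<N}" "\<lambda>k. h \<alpha> (i k)"]
        product_integral_prod[of "{..<N}" "\<lambda>k. h \<alpha> (i k)"])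
  show "integrable (\<Pi>\<^sub>M n\<in>{..<N}. B) (\<lambda>x. \<Sum>\<alpha>\<in>A. c \<alpha> * (\<Prod>k<N. h \<alpha> k (x (\<sigma> k))))"
    unfolding reindex using int by (intro Bochner_Integration.integrable_sum integrable_mult_right) auto
  show "(LINT x|(\<Pi>\<^sub>M n\<in>{..<N}. B). (\<Sum>\<alpha>\<in>A. c \<alpha> * (\<Prod>k<N. h \<alpha> k (x (\<sigma> k)))))
        = (\<Sum>\<alpha>\<in>A. c \<alpha> * (\<Prod>k<N. LINT t|B. h \<alpha> k t))"
    unfolding reindex using int val
    by (subst Bochner_Integration.integral_sum) (auto simp: reindex')
qed

subsection \<open>Invertible ensembles\<close>

locale invertible_polynomial_ensemble =
  fixes I J :: "real set" and N :: nat
    and \<phi>s :: "nat \<Rightarrow> real \<Rightarrow> real" and a :: "nat \<Rightarrow> real"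
    and U :: "complex set" and \<phi> F :: "complex \<Rightarrow> complex \<Rightarrow> complex"
    and \<pi> :: "nat \<Rightarrow> complex poly" and \<gamma> :: "real \<Rightarrow> complex"
  assumes ensemble: "invertible_ensemble I N \<phi>s a U \<phi> \<pi> J \<gamma> F"
begin

abbreviation ca :: "nat \<Rightarrow> complex" where "ca n \<equiv> of_real (a n)"

abbreviation B :: "real measure" where "B \<equiv> restrict_space lborel I"

section \<open>Direct consequences of the definition\<close>

lemma I_sets [measurable]: "I \<in> sets lborel"
  using ensemble real_interval_borel_measurable
  by (auto simp: invertible_ensemble_def polynomial_ensemble_def)

lemma sigma_finite_B: "sigma_finite_measure B"
  by (intro sigma_finite_measure_restrict_space I_sets lborel.sigma_finite_measure_axioms)

lemma integrable_B: "integrable B f \<longleftrightarrow> set_integrable lborel I f"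
  for f :: "real \<Rightarrow> complex"
  by (subst integrable_restrict_space) (use I_sets in \<open>auto simp: set_integrable_def\<close>)

lemma integral_B: "(LINT t|B. f t) = (LINT t:I|lborel. f t)"
  for f :: "real \<Rightarrow> complex"
  by (subst integral_restrict_space) (use I_sets in \<open>auto simp: set_lebesgue_integral_def\<close>)

lemma ca_in_U: "l < N \<Longrightarrow> ca l \<in> U"
  using ensemble by (auto simp: invertible_ensemble_def)

lemma \<phi>s_eq: "l < N \<Longrightarrow> x \<in> I \<Longrightarrow> of_real (\<phi>s l x) = \<phi> (ca l) (of_real x)"
  using ensemble by (auto simp: invertible_ensemble_def)

lemma monic: "degree (\<pi> k) = k" "lead_coeff (\<pi> k) = 1"
  using ensemble unfolding invertible_ensemble_def by blast+

lemma moment_integrable: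
  "l < N \<Longrightarrow> set_integrable lborel I (\<lambda>x. of_real x ^ k * \<phi> (ca l) (of_real x))"
  using ensemble ca_in_U by (auto simp: invertible_ensemble_def)

lemma moment_integral:
  "l < N \<Longrightarrow> (LINT x:I|lborel. of_real x ^ k * \<phi> (ca l) (of_real x)) = poly (\<pi> k) (ca l)"
  using ensemble ca_in_U by (simp add: invertible_ensemble_def)

lemma F_integral: "has_integral_along (\<lambda>s. F s z * poly (\<pi> k) s) (z ^ k) J \<gamma>"
  using ensemble by (auto simp: invertible_ensemble_def)

lemma contour: "contour_on J \<gamma>"
  using ensemble by (auto simp: invertible_ensemble_def)

text \<open>The factor of the \<open>v l\<close>-integration apart from \<open>\<phi>\<close> and
  the Vandermonde; the same factor arises when the expectation is split along
  \<open>x = (v, w)\<close>.\<close>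

definition ratio_kernel :: "(nat \<Rightarrow> complex) \<Rightarrow> (nat \<Rightarrow> complex) \<Rightarrow> nat \<Rightarrow> nat \<Rightarrow> nat \<Rightarrow> nat \<Rightarrow> real \<Rightarrow> complex" where
  "ratio_kernel z y M L K l t = (of_real t / y l) ^ K * ((\<Prod>m<M. z m - of_real t) / (\<Prod>j<L. y j - of_real t))"

text \<open>The \<open>v\<close>-integrals of the theorem after \<open>u\<^sub>l\<close> has been set to \<open>a\<^bsub>\<iota> l\<^esub>\<close>, with \<open>\<Delta>\<^sub>L(v)\<close> expanded.\<close>

definition ratio_integral :: "(nat \<Rightarrow> complex) \<Rightarrow> (nat \<Rightarrow> complex) \<Rightarrow> nat \<Rightarrow> nat \<Rightarrow> nat \<Rightarrow> (nat \<Rightarrow> nat) \<Rightarrow> complex" where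
  "ratio_integral z y M L K \<iota> = (\<Sum>\<tau>\<in>perms L. of_int (sign \<tau>) *
     (\<Prod>l<L. LINT t:I|lborel. ratio_kernel z y M L K l t * (of_real t ^ (L - 1 - \<tau> l) * \<phi> (ca (\<iota> l)) (of_real t))))"

text \<open>\<open>\<Delta>\<^bsub>M+K\<^esub>(z, w)\<close> with \<open>w\<^sub>n\<close> integrated against \<open>\<phi>(b\<^sub>n, \<cdot>)\<close>.\<close>

definition moment_vandermonde :: "(nat \<Rightarrow> complex) \<Rightarrow> nat \<Rightarrow> nat \<Rightarrow> (nat \<Rightarrow> complex) \<Rightarrow> complex" where
  "moment_vandermonde z M K b = (\<Sum>\<rho>\<in>perms (M + K). of_int (sign \<rho>) *
     ((\<Prod>j<M. z j ^ (M + K - 1 - \<rho> j)) * (\<Prod>n<K. poly (\<pi> (M + K - 1 - \<rho> (M + n))) (b n))))"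

text \<open>The finite sum to which both sides reduce up to explicit constants:
  \<open>\<sigma>\<close> decides which parameters go to the \<open>v\<close> and which to the
  \<open>w\<close>.\<close>

definition reduced_sum :: "(nat \<Rightarrow> complex) \<Rightarrow> (nat \<Rightarrow> complex) \<Rightarrow> nat \<Rightarrow> nat \<Rightarrow> nat \<Rightarrow> complex" where
  "reduced_sum z y M L K = (\<Sum>\<sigma>\<in>perms N. of_int (sign \<sigma>) *
     (ratio_integral z y M L K \<sigma> * moment_vandermonde z M K (\<lambda>n. ca (\<sigma> (L + n)))))"

section \<open>Integrability against the ensemble functions\<close>

lemma bounded_cauchy_factor:
  assumes "w \<notin> \<real>"
  shows "cmod (1 / (w - of_real t)) \<le> 1 / \<bar>Im w\<bar>"
proof -
  have "Im w \<noteq> 0" using assms by (simp add: complex_is_Real_iff)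
  moreover have "\<bar>Im w\<bar> \<le> cmod (w - of_real t)"
    using abs_Im_le_cmod[of "w - of_real t"] by simp
  ultimately show ?thesis
    using frac_le[of 1 1 "\<bar>Im w\<bar>" "cmod (w - of_real t)"] by (simp add: norm_divide)
qed

lemma poly_moment_integrable:
  assumes "i < N"
  shows "set_integrable lborel I (\<lambda>t. poly p (of_real t) * \<phi> (ca i) (of_real t))"
proof -
  have "set_integrable lborel I
      (\<lambda>t. \<Sum>k\<le>degree p. coeff p k * (of_real t ^ k * \<phi> (ca i) (of_real t)))"
    unfolding set_integrable_def scaleR_sum_right
  proof (rule Bochner_Integration.integrable_sum)
    fix k
    show "integrable lborel (\<lambda>t. indicator I t *\<^sub>R (coeff p k * (of_real t ^ k * \<phi> (ca i) (of_real t))))"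
      using set_integrable_mult_right[of "coeff p k", OF moment_integrable[OF assms, of k]]
      by (simp add: set_integrable_def)
  qed
  then show ?thesis
    by (simp add: poly_altdef sum_distrib_right mult.assoc)
qed

text \<open>Apart from \<open>\<phi>\<close> the integrand is a polynomial times Cauchy factors.
  Those are bounded on the real line because every \<open>y j\<close> has non-zero imaginary part,
  so integrability follows from that of the moments.\<close>

lemma ratio_kernel_moment_integrable:
  assumes y: "\<And>j. j < L \<Longrightarrow> y j \<notin> \<real>" and i: "i < N"
  shows "set_integrable lborel I (\<lambda>t. ratio_kernel z y M L K l t * (of_real t ^ k * \<phi> (ca i) (of_real t)))"
proof -
  define p where "p = [:0, 1 / y l:] ^ K * (\<Prod>m<M. [:z m, -1:]) * [:0, 1:] ^ k"
  have "set_integrable lborel I (\<lambda>t. (\<Prod>j<L. 1 / (y j - of_real t)) * (poly p (of_real t) * \<phi> (ca i) (of_real t)))"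
    unfolding set_integrable_def
  proof (rule Bochner_Integration.integrable_bound)
    let ?c = "\<Prod>j<L. 1 / \<bar>Im (y j)\<bar>"
    let ?f = "\<lambda>t. indicator I t *\<^sub>R (poly p (of_real t) * \<phi> (ca i) (of_real t))"
    show int: "integrable lborel (\<lambda>t. ?c *\<^sub>R ?f t)"
      using poly_moment_integrable[OF i, of p] unfolding set_integrable_def
      by (intro integrable_scaleR_right)
    have [measurable]: "?f \<in> borel_measurable lborel"
      using poly_moment_integrable[OF i, of p] unfolding set_integrable_def
      by (rule borel_measurable_integrable)
    have eq: "indicator I t *\<^sub>R ((\<Prod>j<L. 1 / (y j - of_real t)) * (poly p (of_real t) * \<phi> (ca i) (of_real t)))
        = (\<Prod>j<L. 1 / (y j - of_real t)) * ?f t" for t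
      by simp
    show "(\<lambda>t. indicator I t *\<^sub>R ((\<Prod>j<L. 1 / (y j - of_real t)) * (poly p (of_real t) * \<phi> (ca i) (of_real t))))
      \<in> borel_measurable lborel"
      unfolding eq by measurable
    have "cmod (\<Prod>j<L. 1 / (y j - of_real t)) \<le> ?c" for t
      unfolding prod_norm[symmetric] using bounded_cauchy_factor[OF y]
      by (intro prod_mono) auto
    moreover have "0 \<le> ?c"
      by (intro prod_nonneg) auto
    ultimately show "AE t in lborel. norm (indicator I t *\<^sub>R ((\<Prod>j<L. 1 / (y j - of_real t)) *
        (poly p (of_real t) * \<phi> (ca i) (of_real t)))) \<le> norm (?c *\<^sub>R ?f t)"
      unfolding eq norm_mult norm_scaleR by (intro AE_I2 mult_right_mono) auto
  qed
  moreover have "ratio_kernel z y M L K l t * (of_real t ^ k * \<phi> (ca i) (of_real t))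
      = (\<Prod>j<L. 1 / (y j - of_real t)) * (poly p (of_real t) * \<phi> (ca i) (of_real t))" for t
    by (simp add: ratio_kernel_def p_def poly_prod prod_dividef power_divide mult_ac)
  ultimately show ?thesis by (simp only:)
qed

section \<open>The expectation as a reduced sum\<close>

definition lhs_integrand ::
    "(nat \<Rightarrow> complex) \<Rightarrow> (nat \<Rightarrow> complex) \<Rightarrow> nat \<Rightarrow> nat \<Rightarrow> nat \<Rightarrow> (nat \<Rightarrow> real) \<Rightarrow> complex" where
  "lhs_integrand z y M L K x =
     vandermonde L (\<lambda>l. of_real (x l)) * (\<Prod>l<L. ratio_kernel z y M L K l (x l)) *
     vandermonde (M + K) (\<lambda>i. if i < M then z i else of_real (x (L + (i - M)))) *
     Determinant.det (Matrix.mat N N (\<lambda>(k, l). \<phi> (ca l) (of_real (x k))))"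

text \<open>\<open>lhs_integrand\<close> is one term of the antisymmetrised integrand: coordinates
  below \<open>L\<close> are the \<open>v\<close>, the others the \<open>w\<close>, already merged
  with \<open>z\<close>. Expanding its two Vandermondes and its determinant leaves products of
  functions of one variable; integration over the \<open>w\<close> gives moments, that is values of
  the \<open>\<pi>\<close>. The symmetry of the product measure makes the result independent of
  \<open>\<sigma>\<close>.\<close>

lemma integral_lhs_integrand:
  assumes N: "N = L + K" and y: "\<And>j. j < L \<Longrightarrow> y j \<notin> \<real>" and \<sigma>: "\<sigma> \<in> perms N"
  shows "integrable (lebesgue_power I N) (\<lambda>x. lhs_integrand z y M L K (\<lambda>k. x (\<sigma> k)))" (is ?int)
    and "(LINT x|lebesgue_power I N. lhs_integrand z y M L K (\<lambda>k. x (\<sigma> k))) = reduced_sum z y M L K" (is ?val)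
proof -
  define A where "A = perms L \<times> perms (M + K) \<times> perms N"
  define c :: "(nat \<Rightarrow> nat) \<times> (nat \<Rightarrow> nat) \<times> (nat \<Rightarrow> nat) \<Rightarrow> complex" where "c = (\<lambda>(\<tau>, \<rho>, p). of_int (sign \<tau>) * of_int (sign \<rho>) * of_int (sign p) * (\<Prod>j<M. z j ^ (M + K - 1 - \<rho> j)))"
  \<comment> \<open>\<open>\<tau>\<close>, \<open>\<rho>\<close> and \<open>p\<close> come from the
    Vandermonde of the \<open>v\<close>, the merged Vandermonde and the determinant. A coordinate
    \<open>k \<ge> L\<close> is number \<open>k - L\<close> among the \<open>w\<close>, hence number
    \<open>M + (k - L)\<close> in the merged Vandermonde.\<close>
  define h where "h = (\<lambda>(\<tau>, \<rho>, p) k t. if k < L then ratio_kernel z y M L K k t * (of_real t ^ (L - 1 - \<tau> k) * \<phi> (ca (p k)) (of_real t))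
    else of_real t ^ (M + K - 1 - \<rho> (M + (k - L))) * \<phi> (ca (p k)) (of_real t))"
  have expand: "lhs_integrand z y M L K x = (\<Sum>\<alpha>\<in>A. c \<alpha> * (\<Prod>k<N. h \<alpha> k (x k)))" for x
  proof -
    have V: "vandermonde L (\<lambda>l. complex_of_real (x l)) * (\<Prod>l<L. ratio_kernel z y M L K l (x l))
        = (\<Sum>\<tau>\<in>perms L. of_int (sign \<tau>) * (\<Prod>l<L. ratio_kernel z y M L K l (x l) * of_real (x l) ^ (L - 1 - \<tau> l)))"
      by (rule vandermonde_mult_prod)
    have W: "vandermonde (M + K) (\<lambda>i. if i < M then z i else of_real (x (L + (i - M))))
        = (\<Sum>\<rho>\<in>perms (M + K). of_int (sign \<rho>) * ((\<Prod>j<M. z j ^ (M + K - 1 - \<rho> j)) *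
            (\<Prod>n<K. of_real (x (L + n)) ^ (M + K - 1 - \<rho> (M + n)))))"
      by (simp add: vandermonde_expand_powers prod_lessThan_add)
    have D: "Determinant.det (Matrix.mat N N (\<lambda>(k, l). \<phi> (ca l) (of_real (x k))))
        = (\<Sum>p\<in>perms N. of_int (sign p) * ((\<Prod>l<L. \<phi> (ca (p l)) (of_real (x l))) *
             (\<Prod>n<K. \<phi> (ca (p (L + n))) (of_real (x (L + n))))))"
      by (simp add: det_mat_expand N prod_lessThan_add)
    have "(\<Prod>k<N. h (\<tau>, \<rho>, p) k (x k)) = (\<Prod>l<L. ratio_kernel z y M L K l (x l) * of_real (x l) ^ (L - 1 - \<tau> l)) *
        (\<Prod>l<L. \<phi> (ca (p l)) (of_real (x l))) * ((\<Prod>n<K. of_real (x (L + n)) ^ (M + K - 1 - \<rho> (M + n))) *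
        (\<Prod>n<K. \<phi> (ca (p (L + n))) (of_real (x (L + n)))))" for \<tau> \<rho> p
      by (simp add: h_def N prod_lessThan_add prod.distrib mult_ac)
    then have "c (\<tau>, \<rho>, p) * (\<Prod>k<N. h (\<tau>, \<rho>, p) k (x k))
        = (of_int (sign \<tau>) * (\<Prod>l<L. ratio_kernel z y M L K l (x l) * of_real (x l) ^ (L - 1 - \<tau> l))) *
          ((of_int (sign \<rho>) * ((\<Prod>j<M. z j ^ (M + K - 1 - \<rho> j)) *
            (\<Prod>n<K. of_real (x (L + n)) ^ (M + K - 1 - \<rho> (M + n))))) *
          (of_int (sign p) * ((\<Prod>l<L. \<phi> (ca (p l)) (of_real (x l))) *
             (\<Prod>n<K. \<phi> (ca (p (L + n))) (of_real (x (L + n)))))))" for \<tau> \<rho> p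
      by (simp add: c_def mult_ac)
    then have cf: "(\<Sum>\<alpha>\<in>A. c \<alpha> * (\<Prod>k<N. h \<alpha> k (x k))) = (\<Sum>(\<tau>, \<rho>, p)\<in>A.
        (of_int (sign \<tau>) * (\<Prod>l<L. ratio_kernel z y M L K l (x l) * of_real (x l) ^ (L - 1 - \<tau> l))) *
          ((of_int (sign \<rho>) * ((\<Prod>j<M. z j ^ (M + K - 1 - \<rho> j)) *
            (\<Prod>n<K. of_real (x (L + n)) ^ (M + K - 1 - \<rho> (M + n))))) *
          (of_int (sign p) * ((\<Prod>l<L. \<phi> (ca (p l)) (of_real (x l))) *
             (\<Prod>n<K. \<phi> (ca (p (L + n))) (of_real (x (L + n))))))))"
      by (intro sum.cong refl) (simp only: split_paired_all case_prod_conv)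
    show ?thesis
      unfolding cf unfolding lhs_integrand_def V W D A_def
      by (rule sum_product_triple)
  qed
  have h: "integrable B (h \<alpha> k)" if \<alpha>A: "\<alpha> \<in> A" and k: "k < N" for \<alpha> k
  proof -
    obtain \<tau> \<rho> p where \<alpha>: "\<alpha> = (\<tau>, \<rho>, p)" "p \<in> perms N" using \<alpha>A by (auto simp: A_def)
    have "p k < N" using permutes_in_image[of p "{..<N}" k] \<alpha>(2) k by simp
    then show ?thesis
      using moment_integrable ratio_kernel_moment_integrable[OF y]
      by (cases "k < L") (simp_all add: integrable_B \<alpha> h_def)
  qed
  have h_val: "c (\<tau>, \<rho>, p) * (\<Prod>k<N. LINT t|B. h (\<tau>, \<rho>, p) k t)
     = of_int (sign p) * ((of_int (sign \<tau>) * (\<Prod>l<L. LINT t:I|lborel. ratio_kernel z y M L K l t *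
          (of_real t ^ (L - 1 - \<tau> l) * \<phi> (ca (p l)) (of_real t)))) *
        (of_int (sign \<rho>) * ((\<Prod>j<M. z j ^ (M + K - 1 - \<rho> j)) *
          (\<Prod>n<K. poly (\<pi> (M + K - 1 - \<rho> (M + n))) (ca (p (L + n)))))))" if p: "p \<in> perms N" for \<tau> \<rho> p
  proof -
    have lt: "p k < N" if "k < N" for k
      using permutes_in_image[of p "{..<N}" k] p that by simp
    have "(\<Prod>k<N. LINT t|B. h (\<tau>, \<rho>, p) k t) =
        (\<Prod>l<L. LINT t:I|lborel. ratio_kernel z y M L K l t * (of_real t ^ (L - 1 - \<tau> l) * \<phi> (ca (p l)) (of_real t))) *
        (\<Prod>n<K. LINT t:I|lborel. of_real t ^ (M + K - 1 - \<rho> (M + n)) * \<phi> (ca (p (L + n))) (of_real t))"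
      unfolding N prod_lessThan_add by (simp add: integral_B h_def)
    also have "(\<Prod>n<K. LINT t:I|lborel. of_real t ^ (M + K - 1 - \<rho> (M + n)) * \<phi> (ca (p (L + n))) (of_real t))
        = (\<Prod>n<K. poly (\<pi> (M + K - 1 - \<rho> (M + n))) (ca (p (L + n))))"
      using lt by (intro prod.cong) (auto simp: moment_integral N)
    finally show ?thesis
      by (simp add: c_def mult_ac)
  qed
  show ?int
    unfolding expand lebesgue_power_def
    by (rule integrable_PiM_sum_prod[OF sigma_finite_B \<sigma> h])
  have "(LINT x|lebesgue_power I N. lhs_integrand z y M L K (\<lambda>k. x (\<sigma> k)))
      = (\<Sum>\<alpha>\<in>A. c \<alpha> * (\<Prod>k<N. LINT t|B. h \<alpha> k t))"
    unfolding expand lebesgue_power_def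
    by (rule integral_PiM_sum_prod[OF sigma_finite_B \<sigma> h])
  also have "\<dots> = (\<Sum>\<tau>\<in>perms L. \<Sum>\<rho>\<in>perms (M + K). \<Sum>p\<in>perms N. c (\<tau>, \<rho>, p) * (\<Prod>k<N. LINT t|B. h (\<tau>, \<rho>, p) k t))"
    by (simp add: A_def sum.cartesian_product')
  \<comment> \<open>The permutation \<open>p\<close> of the determinant becomes the outer sum; it is
    the \<open>\<sigma>\<close> of \<open>reduced_sum\<close>.\<close>
  also have "\<dots> = (\<Sum>p\<in>perms N. \<Sum>\<tau>\<in>perms L. \<Sum>\<rho>\<in>perms (M + K). c (\<tau>, \<rho>, p) * (\<Prod>k<N. LINT t|B. h (\<tau>, \<rho>, p) k t))"
    by (subst (2) sum.swap, subst sum.swap) simp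
  also have "\<dots> = reduced_sum z y M L K"
    unfolding reduced_sum_def ratio_integral_def moment_vandermonde_def
    by (intro sum.cong[OF refl]) (simp only: h_val sum_product, simp only: sum_distrib_left)
  finally show ?val .
qed

text \<open>\<open>vandermonde_div_prod\<close> multiplied by the determinant and by the numerators.
  The sign of \<open>\<sigma>\<close> in that identity is the one the determinant acquires when its
  rows are permuted, and the numerators split into the parts for the \<open>v\<close> and for the
  \<open>w\<close>.\<close>

lemma weight_eq_sum:
  assumes N: "N = L + K" and y: "\<And>j. j < L \<Longrightarrow> y j \<notin> \<real>" and yinj: "inj_on y {..<L}"
    and x: "\<And>k. k < N \<Longrightarrow> x k \<in> I"
  shows "fact L * fact K * vandermonde M z * (of_real (ensemble_weight N \<phi>s x) *
      ((\<Prod>m<M. char_fun N x (z m)) / (\<Prod>l<L. char_fun N x (y l))))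
    = (\<Sum>\<sigma>\<in>perms N. lhs_integrand z y M L K (\<lambda>k. x (\<sigma> k)))"
proof -
  define X where "X = (\<lambda>k. complex_of_real (x k))"
  define D where "D = Determinant.det (Matrix.mat N N (\<lambda>(k, l). \<phi> (ca l) (X k)))"
  have det: "of_real (Determinant.det (Matrix.mat N N (\<lambda>(k, l). \<phi>s l (x k)))) = D"
    unfolding D_def det_mat_expand of_real_sum of_real_mult of_real_prod of_real_of_int_eq
  proof (intro sum.cong arg_cong2[where f = "(*)"] prod.cong refl)
    fix p i assume "p \<in> perms N" "i \<in> {..<N}"
    then show "complex_of_real (case (i, p i) of (k, l) \<Rightarrow> \<phi>s l (x k)) = (case (i, p i) of (k, l) \<Rightarrow> \<phi> (ca l) (X k))"
      using permutes_in_image[of p "{..<N}" i] x by (simp add: \<phi>s_eq X_def)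
  qed
  have weight: "of_real (ensemble_weight N \<phi>s x) = vandermonde N X * D"
    unfolding ensemble_weight_def of_real_mult det by (simp add: vandermonde_def X_def case_prod_beta')
  have det_perm: "Determinant.det (Matrix.mat N N (\<lambda>(k, l). \<phi> (ca l) (X (\<sigma> k)))) = of_int (sign \<sigma>) * D"
    if "\<sigma> \<in> perms N" for \<sigma>
    unfolding D_def by (rule det_perm_rows[OF that])
  have summand: "lhs_integrand z y M L K (\<lambda>k. x (\<sigma> k)) = vandermonde M z * (\<Prod>m<M. char_fun N x (z m)) * D *
      (of_int (sign \<sigma>) * (vandermonde L (\<lambda>l. X (\<sigma> l)) * vandermonde K (\<lambda>n. X (\<sigma> (L + n))) *
         (\<Prod>l<L. (X (\<sigma> l) / y l) ^ K / (\<Prod>j<L. y j - X (\<sigma> l)))))" if \<sigma>: "\<sigma> \<in> perms N" for \<sigma>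
  proof -
    have perm: "(\<Prod>k<N. f k) = (\<Prod>k<N. f (\<sigma> k))" for f :: "nat \<Rightarrow> complex"
      using prod.permute[of \<sigma> "{..<N}" f] \<sigma> by (simp add: o_def)
    have char: "char_fun N x w = (\<Prod>k<N. w - X (\<sigma> k))" for w
      using perm[of "\<lambda>k. w - X k"] by (simp add: char_fun_def X_def)
    have swap: "(\<Prod>m<M. \<Prod>l<L. z m - X (\<sigma> l)) = (\<Prod>l<L. \<Prod>m<M. z m - X (\<sigma> l))"
      by (rule prod.swap)
    have chars: "(\<Prod>m<M. char_fun N x (z m))
        = (\<Prod>l<L. \<Prod>m<M. z m - X (\<sigma> l)) * (\<Prod>m<M. \<Prod>n<K. z m - X (\<sigma> (L + n)))"
      unfolding char unfolding N prod_lessThan_add prod.distrib swap ..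
    have kerns: "(\<Prod>l<L. ratio_kernel z y M L K l (x (\<sigma> l)))
        = (\<Prod>l<L. \<Prod>m<M. z m - X (\<sigma> l)) * (\<Prod>l<L. (X (\<sigma> l) / y l) ^ K / (\<Prod>j<L. y j - X (\<sigma> l)))"
      unfolding prod.distrib[symmetric] by (intro prod.cong refl) (simp add: ratio_kernel_def X_def)
    have vm: "vandermonde (M + K) (\<lambda>i. if i < M then z i else X (\<sigma> (L + (i - M))))
        = vandermonde M z * (\<Prod>m<M. \<Prod>n<K. z m - X (\<sigma> (L + n))) * vandermonde K (\<lambda>n. X (\<sigma> (L + n)))"
      unfolding vandermonde_add using vandermonde_cong[of M "\<lambda>i. if i < M then z i else X (\<sigma> (L + (i - M)))" z] by simp
    have "lhs_integrand z y M L K (\<lambda>k. x (\<sigma> k)) = vandermonde L (\<lambda>l. X (\<sigma> l)) *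
       (\<Prod>l<L. ratio_kernel z y M L K l (x (\<sigma> l))) * vandermonde (M + K) (\<lambda>i. if i < M then z i else X (\<sigma> (L + (i - M)))) *
       (of_int (sign \<sigma>) * D)"
      unfolding lhs_integrand_def det_perm[OF \<sigma>, symmetric] by (simp only: X_def)
    then show ?thesis
      unfolding kerns vm chars by (simp only: mult_ac)
  qed
  have "(\<Sum>\<sigma>\<in>perms N. lhs_integrand z y M L K (\<lambda>k. x (\<sigma> k))) = vandermonde M z * (\<Prod>m<M. char_fun N x (z m)) * D *
      (\<Sum>\<sigma>\<in>perms N. of_int (sign \<sigma>) * (vandermonde L (\<lambda>l. X (\<sigma> l)) * vandermonde K (\<lambda>n. X (\<sigma> (L + n))) *
         (\<Prod>l<L. (X (\<sigma> l) / y l) ^ K / (\<Prod>j<L. y j - X (\<sigma> l)))))"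
    by (simp add: summand sum_distrib_left)
  also have "\<dots> = vandermonde M z * (\<Prod>m<M. char_fun N x (z m)) * D *
      (fact L * fact K * (vandermonde N X / (\<Prod>l<L. \<Prod>n<N. y l - X n)))"
  proof (cases "inj_on X {..<N}")
    case True
    have "fact L * fact K * (vandermonde (L + K) X / (\<Prod>l<L. \<Prod>n<L + K. y l - X n))
    = (\<Sum>\<sigma>\<in>perms (L + K). of_int (sign \<sigma>) * (vandermonde L (\<lambda>l. X (\<sigma> l)) *
         vandermonde K (\<lambda>n. X (\<sigma> (L + n))) *
         (\<Prod>l<L. (X (\<sigma> l) / y l) ^ K / (\<Prod>j<L. y j - X (\<sigma> l)))))"
    proof (rule vandermonde_div_prod)
      show "y l \<noteq> X n" if "l < L" for l n
        using y[OF that] by (auto simp: X_def)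
      show "y l \<noteq> 0" if "l < L" for l
        using y[OF that] by auto
    qed (use True yinj N in auto)
    then show ?thesis by (simp add: N)
  next
    \<comment> \<open>With coinciding coordinates the interpolation nodes are not distinct, but the
      determinant has two equal rows and both sides are zero.\<close>
    case False
    then obtain i j where ij: "i < N" "j < N" "i \<noteq> j" "X i = X j"
      by (auto simp: inj_on_def)
    have "D = 0"
      unfolding D_def
      by (rule det_identical_rows[OF _ ij(3,1,2)]) (use ij in \<open>auto intro!: eq_vecI\<close>)
    then show ?thesis by simp
  qed
  finally show ?thesis
    unfolding weight by (simp add: char_fun_def X_def mult_ac)
qed

lemma integral_weight:
  assumes N: "N = L + K" and y: "\<And>j. j < L \<Longrightarrow> y j \<notin> \<real>" and yinj: "inj_on y {..<L}"
  shows "fact L * fact K * vandermonde M z * (LINT x|lebesgue_power I N. of_real (ensemble_weight N \<phi>s x) *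
      ((\<Prod>m<M. char_fun N x (z m)) / (\<Prod>l<L. char_fun N x (y l))))
    = fact N * reduced_sum z y M L K"
proof -
  have "fact L * fact K * vandermonde M z * (LINT x|lebesgue_power I N. of_real (ensemble_weight N \<phi>s x) *
      ((\<Prod>m<M. char_fun N x (z m)) / (\<Prod>l<L. char_fun N x (y l))))
     = (LINT x|lebesgue_power I N. fact L * fact K * vandermonde M z * (of_real (ensemble_weight N \<phi>s x) *
      ((\<Prod>m<M. char_fun N x (z m)) / (\<Prod>l<L. char_fun N x (y l)))))"
    by (rule integral_mult_right_zero[symmetric])
  also have "\<dots> = (LINT x|lebesgue_power I N. (\<Sum>\<sigma>\<in>perms N. lhs_integrand z y M L K (\<lambda>k. x (\<sigma> k))))"
  proof (rule Bochner_Integration.integral_cong[OF refl])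
    fix x assume "x \<in> space (lebesgue_power I N)"
    then have "x k \<in> I" if "k < N" for k
      using that by (auto simp: lebesgue_power_def space_PiM PiE_def Pi_def space_restrict_space)
    then show "fact L * fact K * vandermonde M z * (of_real (ensemble_weight N \<phi>s x) *
      ((\<Prod>m<M. char_fun N x (z m)) / (\<Prod>l<L. char_fun N x (y l))))
      = (\<Sum>\<sigma>\<in>perms N. lhs_integrand z y M L K (\<lambda>k. x (\<sigma> k)))"
      by (intro weight_eq_sum[OF N y yinj]) auto
  qed
  also have "\<dots> = (\<Sum>\<sigma>\<in>perms N. reduced_sum z y M L K)"
    using integral_lhs_integrand[OF N y]
    by (subst Bochner_Integration.integral_sum) auto
  also have "\<dots> = fact N * reduced_sum z y M L K"
    by (simp add: card_permutations)
  finally show ?thesis .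
qed

text \<open>The case \<open>L = M = 0\<close> of \<open>integral_weight\<close>, where the ratio is
  \<open>1\<close> and \<open>moment_vandermonde\<close> is the Vandermonde of the parameters
  expanded in the \<open>\<pi>\<close>.\<close>

lemma ensemble_const_eq: "of_real (ensemble_const I N \<phi>s) = fact N * vandermonde N ca"
proof -
  have W: "moment_vandermonde z 0 N b = vandermonde N b" for z b
    unfolding moment_vandermonde_def by (simp add: vandermonde_expand[of \<pi>, OF monic])
  have "of_real (ensemble_const I N \<phi>s) = (LINT x|lebesgue_power I N. complex_of_real (ensemble_weight N \<phi>s x))"
    by (simp add: ensemble_const_def)
  also have "fact 0 * fact N * vandermonde 0 (\<lambda>_. 0) * \<dots> = fact N * reduced_sum (\<lambda>_. 0) (\<lambda>_. 0) 0 0 N"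
    using integral_weight[of 0 N "\<lambda>_. 0" 0 "\<lambda>_. 0"] by simp
  also have "reduced_sum (\<lambda>_. 0) (\<lambda>_. 0) 0 0 N = (\<Sum>\<sigma>\<in>perms N. of_int (sign \<sigma>) * (of_int (sign \<sigma>) * vandermonde N ca))"
    unfolding reduced_sum_def W
    by (intro sum.cong refl) (simp add: ratio_integral_def vandermonde_perm[of _ N ca])
  also have "\<dots> = fact N * vandermonde N ca"
    by (rule sum_perms_sign_cancel)
  finally show ?thesis
    by (simp add: vandermonde_def[of 0])
qed

lemma ensemble_const_nonzero: "vandermonde N ca \<noteq> 0"
proof -
  have "ensemble_const I N \<phi>s \<noteq> 0"
    using ensemble by (simp add: invertible_ensemble_def polynomial_ensemble_def)
  then have "complex_of_real (ensemble_const I N \<phi>s) \<noteq> 0" by simp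
  then show ?thesis
    unfolding ensemble_const_eq by simp
qed

text \<open>Equal parameters would make the normalisation zero. Distinctness turns all
  \<open>ca n\<close> into simple poles of \<open>1 / (\<Prod>n<N. t - ca n)\<close>.\<close>

lemma inj_ca: "inj_on ca {..<N}"
proof (rule inj_onI, rule ccontr)
  fix i j assume "i \<in> {..<N}" "j \<in> {..<N}" "ca i = ca j" "i \<noteq> j"
  then have "vandermonde N ca = 0"
    by (intro vandermonde_eq_0[of i N j]) auto
  then show False using ensemble_const_nonzero by contradiction
qed

lemma expectation_eq_reduced_sum:
  assumes N: "N = L + K" and y: "\<And>j. j < L \<Longrightarrow> y j \<notin> \<real>" and yinj: "inj_on y {..<L}"
    and zinj: "inj_on z {..<M}"
  shows "(LINT x|ensemble_measure I N \<phi>s.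
      (\<Prod>m<M. char_fun N x (z m)) / (\<Prod>l<L. char_fun N x (y l)))
    = reduced_sum z y M L K / (fact L * fact K * vandermonde M z * vandermonde N ca)"
proof -
  let ?R = "\<lambda>x. (\<Prod>m<M. char_fun N x (z m)) / (\<Prod>l<L. char_fun N x (y l))"
  let ?Z = "ensemble_const I N \<phi>s"
  have poly: "polynomial_ensemble I N \<phi>s"
    using ensemble by (simp add: invertible_ensemble_def)
  have comp: "(\<lambda>x. x n) \<in> borel_measurable (lebesgue_power I N)" if "n < N" for n
    unfolding lebesgue_power_def
    by (rule measurable_compose[OF measurable_component_singleton[of n "{..<N}"]])
      (use that in \<open>auto intro: measurable_restrict_space1\<close>)
  have [measurable]: "(\<lambda>x. char_fun N x w) \<in> borel_measurable (lebesgue_power I N)" for w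
    unfolding char_fun_def using comp by (intro borel_measurable_prod borel_measurable_diff) auto
  have R: "?R \<in> borel_measurable (lebesgue_power I N)"
    by measurable
  have dens: "ensemble_density I N \<phi>s \<in> borel_measurable (lebesgue_power I N)"
    using poly unfolding ensemble_density_def[abs_def] polynomial_ensemble_def
    by (auto dest: borel_measurable_integrable)
  have "(LINT x|ensemble_measure I N \<phi>s. ?R x) = (LINT x|lebesgue_power I N. ensemble_density I N \<phi>s x *\<^sub>R ?R x)"
    unfolding ensemble_measure_def
    by (rule integral_density[OF R dens]) (use poly in \<open>simp add: polynomial_ensemble_def\<close>)
  also have "\<dots> = (LINT x|lebesgue_power I N. (of_real (ensemble_weight N \<phi>s x) * ?R x) / of_real ?Z)"
    by (simp add: ensemble_density_def scaleR_conv_of_real mult.commute)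
  also have "\<dots> = (LINT x|lebesgue_power I N. of_real (ensemble_weight N \<phi>s x) * ?R x) / of_real ?Z"
    by (rule integral_divide_zero)
  \<comment> \<open>\<open>fact N\<close> occurs both in the integral of the weighted ratio and in
    the normalisation, and cancels.\<close>
  also have "\<dots> = reduced_sum z y M L K / (fact L * fact K * vandermonde M z * vandermonde N ca)"
    using integral_weight[OF N y yinj, of M z] vandermonde_neq_0[OF zinj] ensemble_const_nonzero
    unfolding ensemble_const_eq by (simp add: field_simps)
  finally show ?thesis .
qed

section \<open>The nested integral as a reduced sum\<close>

lemma ratio_integral_restrict: "ratio_integral z y M L K (restrict \<iota> {..<L}) = ratio_integral z y M L K \<iota>"
  unfolding ratio_integral_def by (intro sum.cong arg_cong2[where f = "(*)"] prod.cong refl) simp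

lemma phi_holomorphic: "x \<in> I \<Longrightarrow> (\<lambda>u. \<phi> u (of_real x)) holomorphic_on U"
  using ensemble by (auto simp: invertible_ensemble_def intro: analytic_imp_holomorphic)

text \<open>The residue at \<open>u = ca n\<close> of
  \<open>1 / ((\<Prod>m<N. u - ca m) * (\<Prod>j<M. s j - u))\<close>, for \<open>s j\<close> away
  from the parameters.\<close>

definition resid :: "nat \<Rightarrow> (nat \<Rightarrow> complex) \<Rightarrow> nat \<Rightarrow> complex" where
  "resid M s n = 1 / ((\<Prod>m\<in>{..<N} - {n}. ca n - ca m) * (\<Prod>j<M. s j - ca n))"

lemma nested_u_integral:
  assumes c: "\<And>l. l < L \<Longrightarrow> encircles U (ca ` {..<N}) (c l) \<and>
      (\<forall>j<M. s j \<notin> path_image (c l) \<and> winding_number (c l) (s j) = 0)"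
    and s: "\<And>j. j < M \<Longrightarrow> s j \<notin> ca ` {..<N}" and v: "\<And>l. l < L \<Longrightarrow> v l \<in> I"
  shows "nested_integral
      (\<lambda>l g. 1 / (2 * of_real pi * \<i>) * contour_integral (c l)
         (\<lambda>t. 1 / (\<Prod>n<N. t - ca n) * (\<phi> t (of_real (v l)) / (\<Prod>j<M. s j - t)) * g t)) L
      (\<lambda>u. vandermonde L u)
    = (\<Sum>\<iota>\<in>{..<L} \<rightarrow>\<^sub>E {..<N}. vandermonde L (\<lambda>l. ca (\<iota> l)) *
         (\<Prod>l<L. \<phi> (ca (\<iota> l)) (of_real (v l)) * resid M s (\<iota> l)))"
proof -
  let ?T = "\<lambda>l g. 1 / (2 * of_real pi * \<i>) * contour_integral (c l)
         (\<lambda>t. 1 / (\<Prod>n<N. t - ca n) * (\<phi> t (of_real (v l)) / (\<Prod>j<M. s j - t)) * g t)"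
  \<comment> \<open>An entire \<open>g\<close> suffices because only polynomials, built from the
    powers of the Vandermonde expansion, stand in this place. The poles at the \<open>s j\<close>
    form the exceptional set around which the contour does not wind.\<close>
  have T: "?T l g = (\<Sum>n<N. g (ca n) * (\<phi> (ca n) (of_real (v l)) * resid M s n))"
    if l: "l < L" and g: "g holomorphic_on UNIV" for l g
  proof -
    have U: "open U" "connected U" using ensemble by (auto simp: invertible_ensemble_def)
    let ?g = "\<lambda>t. \<phi> t (of_real (v l)) / (\<Prod>j<M. s j - t) * g t"
    have "?T l g = 1 / (2 * of_real pi * \<i>) * contour_integral (c l) (\<lambda>t. ?g t / (\<Prod>n<N. t - ca n))"
      by (simp add: mult.commute)
    also have "\<dots> = (\<Sum>n<N. ?g (ca n) / (\<Prod>m\<in>{..<N} - {n}. ca n - ca m))"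
    proof (rule contour_integral_partial_fraction[OF U inj_ca, where S = "s ` {..<M}"])
      show "?g holomorphic_on U - s ` {..<M}"
        using v[OF l]
        by (intro holomorphic_intros holomorphic_on_subset[OF g] holomorphic_on_subset[OF phi_holomorphic]) auto
    qed (use c[OF l] s ca_in_U in auto)
    also have "\<dots> = (\<Sum>n<N. g (ca n) * (\<phi> (ca n) (of_real (v l)) * resid M s n))"
      by (intro sum.cong refl) (simp add: resid_def mult_ac)
    finally show ?thesis .
  qed
  have "nested_integral ?T L (\<lambda>u. vandermonde L u)
      = nested_integral ?T L (\<lambda>u. \<Sum>\<tau>\<in>perms L. of_int (sign \<tau>) * (\<Prod>l<L. u l ^ (L - 1 - \<tau> l)))"
    by (simp add: vandermonde_expand_powers)
  also have "\<dots> = (\<Sum>\<tau>\<in>perms L. of_int (sign \<tau>) *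
      (\<Prod>l<L. \<Sum>n<N. ca n ^ (L - 1 - \<tau> l) * (\<phi> (ca n) (of_real (v l)) * resid M s n)))"
  proof (rule nested_integral_sum_prod)
    fix l and d :: "(nat \<Rightarrow> nat) \<Rightarrow> complex" assume l: "l < L"
    show "?T l (\<lambda>t. \<Sum>\<tau>\<in>perms L. d \<tau> * t ^ (L - 1 - \<tau> l)) =
        (\<Sum>\<tau>\<in>perms L. d \<tau> * (\<Sum>n<N. ca n ^ (L - 1 - \<tau> l) * (\<phi> (ca n) (of_real (v l)) * resid M s n)))"
      by (subst T[OF l], intro holomorphic_intros, subst sum_distrib_right)
        (subst sum.swap, simp add: sum_distrib_left mult.assoc)
  qed (simp add: finite_permutations)
  also have "\<dots> = (\<Sum>\<iota>\<in>{..<L} \<rightarrow>\<^sub>E {..<N}. vandermonde L (\<lambda>l. ca (\<iota> l)) *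
         (\<Prod>l<L. \<phi> (ca (\<iota> l)) (of_real (v l)) * resid M s (\<iota> l)))"
    by (rule sum_PiE_vandermonde_prod[symmetric, where r = "\<lambda>l n. \<phi> (ca n) (of_real (v l)) * resid M s n"])
  finally show ?thesis .
qed

text \<open>With the poles \<open>\<iota>\<close> fixed, the \<open>v\<close> enter through a
  Vandermonde and one factor each, so the index set consists of pairs of a pole selection and a
  permutation \<open>\<tau>\<close>. Residues are taken only for \<open>v\<close> in the interval,
  where \<open>\<phi>\<close> is holomorphic in its first argument.\<close>

lemma nested_v_integral:
  assumes c: "\<And>l. l < L \<Longrightarrow> encircles U (ca ` {..<N}) (c l) \<and>
      (\<forall>j<M. s j \<notin> path_image (c l) \<and> winding_number (c l) (s j) = 0)"
    and s: "\<And>j. j < M \<Longrightarrow> s j \<notin> ca ` {..<N}" and y: "\<And>j. j < L \<Longrightarrow> y j \<notin> \<real>"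
  shows "nested_integral (\<lambda>l g. LINT t:I|lborel. ratio_kernel z y M L K l t * g t) L
      (\<lambda>v. vandermonde L (\<lambda>l. of_real (v l)) * nested_integral
        (\<lambda>l g. 1 / (2 * of_real pi * \<i>) * contour_integral (c l)
           (\<lambda>t. 1 / (\<Prod>n<N. t - ca n) * (\<phi> t (of_real (v l)) / (\<Prod>j<M. s j - t)) * g t)) L
        (\<lambda>u. vandermonde L u))
    = (\<Sum>\<iota>\<in>{..<L} \<rightarrow>\<^sub>E {..<N}. vandermonde L (\<lambda>l. ca (\<iota> l)) * (\<Prod>l<L. resid M s (\<iota> l)) * ratio_integral z y M L K \<iota>)"
    (is "nested_integral ?T L (\<lambda>v. _ * ?nest v) = _")
proof -
  let ?E = "{..<L} \<rightarrow>\<^sub>E {..<N}"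
  let ?d = "\<lambda>(\<iota>, \<tau>). vandermonde L (\<lambda>l. ca (\<iota> l)) * (\<Prod>l<L. resid M s (\<iota> l)) * of_int (sign \<tau>)"
  let ?h = "\<lambda>(\<iota>, \<tau>) l (t :: real). of_real t ^ (L - 1 - \<tau> l) * \<phi> (ca (\<iota> l)) (of_real t)"
  have E: "finite (?E \<times> perms L)"
    by (intro finite_cartesian_product finite_PiE) (auto simp: finite_permutations)
  have "nested_integral ?T L (\<lambda>v. vandermonde L (\<lambda>l. of_real (v l)) * ?nest v)
      = nested_integral ?T L (\<lambda>v. \<Sum>\<alpha>\<in>?E \<times> perms L. ?d \<alpha> * (\<Prod>l<L. ?h \<alpha> l (v l)))"
  proof (rule nested_integral_cong[where S = I])
    show "?T l f = ?T l g" if "\<And>t. t \<in> I \<Longrightarrow> f t = g t" for l f g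
      using that I_sets by (intro set_lebesgue_integral_cong) auto
    fix v :: "nat \<Rightarrow> real" assume v: "\<And>l. l < L \<Longrightarrow> v l \<in> I"
    have V: "vandermonde L (\<lambda>l. complex_of_real (v l)) * (\<Prod>l<L. \<phi> (ca (\<iota> l)) (of_real (v l)))
        = (\<Sum>\<tau>\<in>perms L. of_int (sign \<tau>) * (\<Prod>l<L. ?h (\<iota>, \<tau>) l (v l)))" for \<iota>
      unfolding vandermonde_mult_prod by (simp add: mult.commute)
    have "?nest v = (\<Sum>\<iota>\<in>?E. vandermonde L (\<lambda>l. ca (\<iota> l)) *
         (\<Prod>l<L. \<phi> (ca (\<iota> l)) (of_real (v l)) * resid M s (\<iota> l)))"
      by (rule nested_u_integral[OF c s v])
    then have "vandermonde L (\<lambda>l. complex_of_real (v l)) * ?nest v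
        = (\<Sum>\<iota>\<in>?E. vandermonde L (\<lambda>l. ca (\<iota> l)) * (\<Prod>l<L. resid M s (\<iota> l)) *
             (vandermonde L (\<lambda>l. complex_of_real (v l)) * (\<Prod>l<L. \<phi> (ca (\<iota> l)) (of_real (v l)))))"
      by (simp only: sum_distrib_left prod.distrib mult_ac)
    also have "\<dots> = (\<Sum>\<alpha>\<in>?E \<times> perms L. ?d \<alpha> * (\<Prod>l<L. ?h \<alpha> l (v l)))"
      unfolding V sum_distrib_left sum.cartesian_product
      by (intro sum.cong refl) (simp only: split_def mult.assoc fst_conv snd_conv)
    finally show "vandermonde L (\<lambda>l. complex_of_real (v l)) * ?nest v
        = (\<Sum>\<alpha>\<in>?E \<times> perms L. ?d \<alpha> * (\<Prod>l<L. ?h \<alpha> l (v l)))" .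
  qed
  also have "\<dots> = (\<Sum>\<alpha>\<in>?E \<times> perms L. ?d \<alpha> * (\<Prod>l<L. ?T l (?h \<alpha> l)))"
  proof (rule nested_integral_sum_prod[OF E])
    fix l and d :: "(nat \<Rightarrow> nat) \<times> (nat \<Rightarrow> nat) \<Rightarrow> complex" assume l: "l < L"
    have "?T l (\<lambda>t. \<Sum>\<alpha>\<in>?E \<times> perms L. d \<alpha> * ?h \<alpha> l t)
        = (LINT t:I|lborel. (\<Sum>\<alpha>\<in>?E \<times> perms L. d \<alpha> * (ratio_kernel z y M L K l t * ?h \<alpha> l t)))"
      by (simp only: sum_distrib_left mult.left_commute)
    also have "\<dots> = (\<Sum>\<alpha>\<in>?E \<times> perms L. (LINT t:I|lborel. d \<alpha> * (ratio_kernel z y M L K l t * ?h \<alpha> l t)))"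
      unfolding set_lebesgue_integral_def scaleR_sum_right
    proof (rule Bochner_Integration.integral_sum)
      fix \<alpha> assume "\<alpha> \<in> ?E \<times> perms L"
      then obtain \<iota> \<tau> where "\<alpha> = (\<iota>, \<tau>)" "\<iota> \<in> ?E" by blast
      then have \<alpha>: "\<alpha> = (\<iota>, \<tau>)" "\<iota> l < N"
        using PiE_mem[of \<iota> "{..<L}" "\<lambda>_. {..<N}" l] l by simp_all
      have "set_integrable lborel I (\<lambda>t. d \<alpha> * (ratio_kernel z y M L K l t * ?h \<alpha> l t))"
        using ratio_kernel_moment_integrable[OF y \<alpha>(2)] unfolding \<alpha>(1) case_prod_conv
        by (intro set_integrable_mult_right) auto
      then show "integrable lborel (\<lambda>t. indicator I t *\<^sub>R (d \<alpha> * (ratio_kernel z y M L K l t * ?h \<alpha> l t)))"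
        by (simp only: set_integrable_def)
    qed
    also have "\<dots> = (\<Sum>\<alpha>\<in>?E \<times> perms L. d \<alpha> * ?T l (?h \<alpha> l))"
      by (simp only: set_integral_mult_right)
    finally show "?T l (\<lambda>t. \<Sum>\<alpha>\<in>?E \<times> perms L. d \<alpha> * ?h \<alpha> l t) = (\<Sum>\<alpha>\<in>?E \<times> perms L. d \<alpha> * ?T l (?h \<alpha> l))" .
  qed
  also have "\<dots> = (\<Sum>\<iota>\<in>?E. vandermonde L (\<lambda>l. ca (\<iota> l)) * (\<Prod>l<L. resid M s (\<iota> l)) * ratio_integral z y M L K \<iota>)"
    unfolding ratio_integral_def sum_distrib_left sum.cartesian_product
    by (intro sum.cong refl) (simp only: split_def mult.assoc fst_conv snd_conv)
  finally show ?thesis .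
qed

text \<open>\<open>vandermonde L\<close> removes the non-injective pole selections; each injective
  one is extended to permutations in \<open>fact K\<close> ways. The unselected parameters join
  \<open>s\<close> in a Vandermonde of \<open>M + K\<close> points, which is expanded in the
  \<open>\<pi>\<close> so that (ii) applies to each \<open>s j\<close>.\<close>

lemma residue_sum_eq:
  assumes N: "N = L + K" and s: "\<And>j. j < M \<Longrightarrow> s j \<notin> ca ` {..<N}"
  shows "vandermonde M s * (\<Sum>\<iota>\<in>{..<L} \<rightarrow>\<^sub>E {..<N}.
      vandermonde L (\<lambda>l. ca (\<iota> l)) * (\<Prod>l<L. resid M s (\<iota> l)) * ratio_integral z y M L K \<iota>)
    = (\<Sum>(\<sigma>, \<rho>)\<in>perms N \<times> perms (M + K).
        (-1) ^ (L * (L - 1) div 2) / (fact K * vandermonde N ca) * of_int (sign \<sigma>) * ratio_integral z y M L K \<sigma> *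
        of_int (sign \<rho>) * (\<Prod>n<K. poly (\<pi> (M + K - 1 - \<rho> (M + n))) (ca (\<sigma> (L + n)))) *
        (\<Prod>j<M. poly (\<pi> (M + K - 1 - \<rho> j)) (s j) / (\<Prod>n<N. s j - ca n)))"
proof -
  define e :: complex where "e = (-1) ^ (L * (L - 1) div 2)"
  let ?f = "\<lambda>\<iota>. vandermonde L (\<lambda>l. ca (\<iota> l)) * (\<Prod>l<L. resid M s (\<iota> l)) * ratio_integral z y M L K \<iota>"
  have f0: "?f \<iota> = 0" if ni: "\<not> inj_on \<iota> {..<L}" for \<iota>
  proof -
    have "vandermonde L (\<lambda>l. ca (\<iota> l)) = 0"
      using ni by (auto simp: inj_on_def intro: vandermonde_eq_0)
    then show ?thesis by simp
  qed
  have frestrict: "?f (restrict \<sigma> {..<L}) = ?f \<sigma>" for \<sigma>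
  proof -
    have "vandermonde L (\<lambda>l. ca (restrict \<sigma> {..<L} l)) = vandermonde L (\<lambda>l. ca (\<sigma> l))"
      by (rule vandermonde_cong) simp
    then show ?thesis by (simp only: ratio_integral_restrict) simp
  qed
  have "fact (N - L) * sum ?f ({..<L} \<rightarrow>\<^sub>E {..<N}) = (\<Sum>\<sigma>\<in>perms N. ?f (restrict \<sigma> {..<L}))"
    by (rule sum_perms_eq_sum_injections[symmetric]) (use N f0 in auto)
  then have f_sum: "sum ?f ({..<L} \<rightarrow>\<^sub>E {..<N}) = (\<Sum>\<sigma>\<in>perms N. ?f \<sigma>) / fact K"
    unfolding frestrict by (simp add: N eq_divide_eq mult.commute)
  have summand: "vandermonde M s * ?f \<sigma> / fact K = (\<Sum>\<rho>\<in>perms (M + K).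
        e / (fact K * vandermonde N ca) * of_int (sign \<sigma>) * ratio_integral z y M L K \<sigma> *
        of_int (sign \<rho>) * (\<Prod>n<K. poly (\<pi> (M + K - 1 - \<rho> (M + n))) (ca (\<sigma> (L + n)))) *
        (\<Prod>j<M. poly (\<pi> (M + K - 1 - \<rho> j)) (s j) / (\<Prod>n<N. s j - ca n)))"
    if \<sigma>: "\<sigma> \<in> perms N" for \<sigma>
  proof -
    have p: "\<sigma> permutes {..<N}" using \<sigma> by simp
    have lt: "\<sigma> k < N" if "k < N" for k
      using permutes_in_image[OF p, of k] that by simp
    let ?P = "\<Prod>j<M. \<Prod>l<L. s j - ca (\<sigma> l)"
    let ?Q = "\<Prod>j<M. \<Prod>n<K. s j - ca (\<sigma> (L + n))"
    have nz: "s j - ca (\<sigma> k) \<noteq> 0" if "j < M" "k < N" for j k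
      using s[OF that(1)] lt[OF that(2)] by auto
    have Q0: "?Q \<noteq> 0"
      using nz by (auto simp: N)
    have PQ: "(\<Prod>j<M. \<Prod>n<N. s j - ca n) = ?P * ?Q"
    proof -
      have "(\<Prod>n<N. s j - ca n) = (\<Prod>k<N. s j - ca (\<sigma> k))" for j
        using prod.permute[OF p, of "\<lambda>n. s j - ca n"] by (simp add: o_def)
      then show ?thesis by (simp add: N prod_lessThan_add prod.distrib)
    qed
    have "(\<Prod>l<L. resid M s (\<sigma> l))
        = (\<Prod>l<L. 1 / (\<Prod>m\<in>{..<N} - {\<sigma> l}. ca (\<sigma> l) - ca m)) / (\<Prod>l<L. \<Prod>j<M. s j - ca (\<sigma> l))"
      by (simp add: resid_def prod_dividef prod.distrib)
    also have "(\<Prod>l<L. \<Prod>j<M. s j - ca (\<sigma> l)) = ?P"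
      by (rule prod.swap)
    finally have R: "(\<Prod>l<L. resid M s (\<sigma> l))
        = (\<Prod>l<L. 1 / (\<Prod>m\<in>{..<N} - {\<sigma> l}. ca (\<sigma> l) - ca m)) / ?P" .
    have VR: "vandermonde L (\<lambda>l. ca (\<sigma> l)) * (\<Prod>l<L. resid M s (\<sigma> l))
        = e * of_int (sign \<sigma>) * vandermonde K (\<lambda>n. ca (\<sigma> (L + n))) / vandermonde N ca / ?P"
      unfolding R times_divide_eq_right e_def
      using vandermonde_partial_fraction[of \<sigma> L K ca, folded N] \<sigma> inj_ca by simp
    have W: "vandermonde M s * ?Q * vandermonde K (\<lambda>n. ca (\<sigma> (L + n)))
        = (\<Sum>\<rho>\<in>perms (M + K). of_int (sign \<rho>) * ((\<Prod>j<M. poly (\<pi> (M + K - 1 - \<rho> j)) (s j)) *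
            (\<Prod>n<K. poly (\<pi> (M + K - 1 - \<rho> (M + n))) (ca (\<sigma> (L + n))))))" (is "?lhs = ?rhs")
    proof -
      let ?w = "\<lambda>i. if i < M then s i else ca (\<sigma> (L + (i - M)))"
      have "?lhs = vandermonde (M + K) ?w"
        by (simp add: vandermonde_add vandermonde_cong[of M ?w s])
      also have "\<dots> = ?rhs"
        by (simp add: vandermonde_expand[of \<pi>, OF monic] prod_lessThan_add)
      finally show ?thesis .
    qed
    have "vandermonde M s * ?f \<sigma> / fact K = e / (fact K * vandermonde N ca) * of_int (sign \<sigma>) * ratio_integral z y M L K \<sigma> *
        (vandermonde M s * vandermonde K (\<lambda>n. ca (\<sigma> (L + n))) / ?P)"
      unfolding VR by (simp add: mult_ac)
    \<comment> \<open>Extending the fraction by \<open>?Q\<close> completes the merged Vandermonde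
      above and the full product over \<open>n < N\<close> below; the latter is cancelled by the
      kernel of the \<open>s\<close>-integrals.\<close>
    also have "vandermonde M s * vandermonde K (\<lambda>n. ca (\<sigma> (L + n))) / ?P
        = (vandermonde M s * ?Q * vandermonde K (\<lambda>n. ca (\<sigma> (L + n)))) / (\<Prod>j<M. \<Prod>n<N. s j - ca n)"
      unfolding PQ using Q0 by simp
    finally show ?thesis
      unfolding W sum_distrib_left sum_divide_distrib
      by (simp only: prod_dividef times_divide_eq_left times_divide_eq_right divide_divide_eq_left mult_ac)
  qed
  have "vandermonde M s * sum ?f ({..<L} \<rightarrow>\<^sub>E {..<N}) = (\<Sum>\<sigma>\<in>perms N. vandermonde M s * ?f \<sigma> / fact K)"
    unfolding f_sum by (simp add: sum_distrib_left sum_divide_distrib)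
  also have "\<dots> = (\<Sum>\<sigma>\<in>perms N. \<Sum>\<rho>\<in>perms (M + K).
        e / (fact K * vandermonde N ca) * of_int (sign \<sigma>) * ratio_integral z y M L K \<sigma> *
        of_int (sign \<rho>) * (\<Prod>n<K. poly (\<pi> (M + K - 1 - \<rho> (M + n))) (ca (\<sigma> (L + n)))) *
        (\<Prod>j<M. poly (\<pi> (M + K - 1 - \<rho> j)) (s j) / (\<Prod>n<N. s j - ca n)))"
    by (intro sum.cong refl summand)
  finally show ?thesis
    unfolding e_def sum.cartesian_product .
qed

text \<open>On the zero set of \<open>\<Prod>(t - a\<^sub>n)\<close> the integrand vanishes whatever the value of \<open>g\<close>.\<close>

lemma nested_s_integral:
  assumes "finite A"
    and f: "\<And>s. (\<And>j. j < M \<Longrightarrow> s j \<in> \<gamma> ` J - ca ` {..<N}) \<Longrightarrow>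
      f s = (\<Sum>\<alpha>\<in>A. c \<alpha> * (\<Prod>j<M. poly (\<pi> (k \<alpha> j)) (s j) / (\<Prod>n<N. s j - ca n)))"
  shows "nested_integral (\<lambda>j g. integral_along J \<gamma> (\<lambda>t. F t (z j) * (\<Prod>n<N. t - ca n) * g t)) M f
    = (\<Sum>\<alpha>\<in>A. c \<alpha> * (\<Prod>j<M. z j ^ k \<alpha> j))"
proof -
  let ?T = "\<lambda>j g. integral_along J \<gamma> (\<lambda>t. F t (z j) * (\<Prod>n<N. t - ca n) * g t)"
  let ?h = "\<lambda>\<alpha> j t. poly (\<pi> (k \<alpha> j)) t / (\<Prod>n<N. t - ca n)"
  have "nested_integral ?T M f = nested_integral ?T M (\<lambda>s. \<Sum>\<alpha>\<in>A. c \<alpha> * (\<Prod>j<M. ?h \<alpha> j (s j)))"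
  proof (rule nested_integral_cong[where S = "\<gamma> ` J - ca ` {..<N}"])
    fix j and f g :: "complex \<Rightarrow> complex" assume fg: "\<And>t. t \<in> \<gamma> ` J - ca ` {..<N} \<Longrightarrow> f t = g t"
    have fg': "(\<Prod>n<N. t - ca n) * f t = (\<Prod>n<N. t - ca n) * g t" if "t \<in> \<gamma> ` J" for t
      using fg[of t] that by (cases "t \<in> ca ` {..<N}") auto
    show "?T j f = ?T j g"
      unfolding integral_along_def
    proof (intro integral_cong)
      fix t assume "t \<in> J"
      then show "F (\<gamma> t) (z j) * (\<Prod>n<N. \<gamma> t - ca n) * f (\<gamma> t) * vector_derivative \<gamma> (at t)
          = F (\<gamma> t) (z j) * (\<Prod>n<N. \<gamma> t - ca n) * g (\<gamma> t) * vector_derivative \<gamma> (at t)"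
        using fg'[of "\<gamma> t"] by (simp only: mult.assoc[of "F (\<gamma> t) (z j)"] image_eqI)
    qed
  qed (rule f)
  also have "\<dots> = (\<Sum>\<alpha>\<in>A. c \<alpha> * (\<Prod>j<M. z j ^ k \<alpha> j))"
  proof (rule nested_integral_sum_prod[OF assms(1)])
    fix j and d :: "_ \<Rightarrow> complex"
    have "has_integral_along (\<lambda>s. \<Sum>\<alpha>\<in>A. d \<alpha> * (F s (z j) * poly (\<pi> (k \<alpha> j)) s)) (\<Sum>\<alpha>\<in>A. d \<alpha> * z j ^ k \<alpha> j) J \<gamma>"
      using F_integral unfolding has_integral_along_def sum_distrib_right mult.assoc
      by (intro has_integral_sum[OF assms(1)] has_integral_mult_right) auto
    then have "has_integral_along (\<lambda>t. F t (z j) * (\<Prod>n<N. t - ca n) * (\<Sum>\<alpha>\<in>A. d \<alpha> * ?h \<alpha> j t))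
        (\<Sum>\<alpha>\<in>A. d \<alpha> * z j ^ k \<alpha> j) J \<gamma>"
    proof (rule has_integral_along_off_finite[OF _ contour])
      show "finite (ca ` {..<N})" by simp
      fix s assume "s \<in> \<gamma> ` J - ca ` {..<N}"
      then have "(\<Prod>n<N. s - ca n) \<noteq> 0" by auto
      then show "F s (z j) * (\<Prod>n<N. s - ca n) * (\<Sum>\<alpha>\<in>A. d \<alpha> * ?h \<alpha> j s)
          = (\<Sum>\<alpha>\<in>A. d \<alpha> * (F s (z j) * poly (\<pi> (k \<alpha> j)) s))"
        by (simp add: sum_distrib_left mult_ac)
    qed
    then show "?T j (\<lambda>t. \<Sum>\<alpha>\<in>A. d \<alpha> * ?h \<alpha> j t) = (\<Sum>\<alpha>\<in>A. d \<alpha> * z j ^ k \<alpha> j)"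
      unfolding has_integral_along_def integral_along_def by (rule integral_unique)
  qed
  finally show ?thesis .
qed

text \<open>The \<open>u\<close>, \<open>v\<close> and \<open>s\<close> are integrated out from the
  inside. The contour hypothesis covers exactly those \<open>s\<close> at which
  \<open>nested_s_integral\<close> inspects the integrand.\<close>

lemma nested_integral_eq_reduced_sum:
  assumes N: "N = L + K" and y: "\<And>l. l < L \<Longrightarrow> y l \<notin> \<real>"
    and contours: "\<And>s l. \<forall>j<M. s j \<in> \<gamma> ` J - ca ` {..<N} \<Longrightarrow> l < L \<Longrightarrow>
      encircles U (ca ` {..<N}) (C s l) \<and>
      (\<forall>j<M. s j \<notin> path_image (C s l) \<and> winding_number (C s l) (s j) = 0)"
  shows "nested_integral (\<lambda>j g. integral_along J \<gamma> (\<lambda>t. F t (z j) * (\<Prod>n<N. t - ca n) * g t)) M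
      (\<lambda>s. vandermonde M s * nested_integral (\<lambda>l g. LINT t:I|lborel. ratio_kernel z y M L K l t * g t) L
        (\<lambda>v. vandermonde L (\<lambda>l. of_real (v l)) * nested_integral
          (\<lambda>l g. 1 / (2 * of_real pi * \<i>) * contour_integral (C s l)
             (\<lambda>t. 1 / (\<Prod>n<N. t - ca n) * (\<phi> t (of_real (v l)) / (\<Prod>j<M. s j - t)) * g t)) L
          (\<lambda>u. vandermonde L u)))
    = (-1) ^ (L * (L - 1) div 2) / (fact K * vandermonde N ca) * reduced_sum z y M L K"
    (is "nested_integral ?T M (\<lambda>s. vandermonde M s * ?v s) = _")
proof -
  let ?A = "perms N \<times> perms (M + K)"
  let ?c = "\<lambda>(\<sigma>, \<rho>). (-1) ^ (L * (L - 1) div 2) / (fact K * vandermonde N ca) * of_int (sign \<sigma>) * ratio_integral z y M L K \<sigma> *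
        of_int (sign \<rho>) * (\<Prod>n<K. poly (\<pi> (M + K - 1 - \<rho> (M + n))) (ca (\<sigma> (L + n))))"
  let ?k = "\<lambda>(\<sigma> :: nat \<Rightarrow> nat, \<rho>) j. M + K - 1 - \<rho> j"
  have "nested_integral ?T M (\<lambda>s. vandermonde M s * ?v s) = (\<Sum>\<alpha>\<in>?A. ?c \<alpha> * (\<Prod>j<M. z j ^ ?k \<alpha> j))"
  proof (rule nested_s_integral)
    show "finite ?A" by (simp add: finite_permutations)
    fix s :: "nat \<Rightarrow> complex" assume s: "\<And>j. j < M \<Longrightarrow> s j \<in> \<gamma> ` J - ca ` {..<N}"
    then have s': "\<And>j. j < M \<Longrightarrow> s j \<notin> ca ` {..<N}" by blast
    have "?v s = (\<Sum>\<iota>\<in>{..<L} \<rightarrow>\<^sub>E {..<N}. vandermonde L (\<lambda>l. ca (\<iota> l)) * (\<Prod>l<L. resid M s (\<iota> l)) * ratio_integral z y M L K \<iota>)"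
      by (rule nested_v_integral[OF contours s' y]) (use s in auto)
    then show "vandermonde M s * ?v s = (\<Sum>\<alpha>\<in>?A. ?c \<alpha> * (\<Prod>j<M. poly (\<pi> (?k \<alpha> j)) (s j) / (\<Prod>n<N. s j - ca n)))"
      using residue_sum_eq[OF N s'] by (simp add: split_def)
  qed
  also have "\<dots> = (-1) ^ (L * (L - 1) div 2) / (fact K * vandermonde N ca) * reduced_sum z y M L K"
    unfolding reduced_sum_def moment_vandermonde_def sum_distrib_left sum.cartesian_product
    by (intro sum.cong refl) (simp add: split_def mult_ac)
  finally show ?thesis .
qed

end

text \<open>The contours \<open>C s l\<close> depend on \<open>s\<close> because they must enclose
  the parameters but no \<open>s j\<close>, while the \<open>s j\<close> run along
  \<open>\<gamma>\<close>. The condition is restricted to \<open>s\<close> off the parameters, as no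
  contour can enclose \<open>a n\<close> and exclude it at once.\<close>

theorem theorem2p9:
  fixes I J :: "real set" and N M L :: nat
    and \<phi>s :: "nat \<Rightarrow> real \<Rightarrow> real" and a :: "nat \<Rightarrow> real"
    and U :: "complex set" and \<phi> F :: "complex \<Rightarrow> complex \<Rightarrow> complex"
    and \<pi> :: "nat \<Rightarrow> complex poly" and \<gamma> :: "real \<Rightarrow> complex"
    and z y :: "nat \<Rightarrow> complex"
    and C :: "(nat \<Rightarrow> complex) \<Rightarrow> nat \<Rightarrow> real \<Rightarrow> complex"
  assumes ensemble: "invertible_ensemble I N \<phi>s a U \<phi> \<pi> J \<gamma> F"
    and "L \<le> N"
    and "inj_on z {..<M}" and "inj_on y {..<L}" and "\<And>l. l < L \<Longrightarrow> y l \<notin> \<real>"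
    and contours: "\<And>s l. \<forall>j<M. s j \<in> \<gamma> ` J - (\<lambda>n. of_real (a n)) ` {..<N} \<Longrightarrow> l < L \<Longrightarrow>
      encircles U ((\<lambda>n. of_real (a n)) ` {..<N}) (C s l) \<and>
      (\<forall>j<M. s j \<notin> path_image (C s l) \<and> winding_number (C s l) (s j) = 0)"
  shows "(LINT x|ensemble_measure I N \<phi>s.
            (\<Prod>m<M. char_fun N x (z m)) / (\<Prod>l<L. char_fun N x (y l))) =
    (-1) ^ (L * (L - 1) div 2) / (of_nat (fact L) * vandermonde M z) *
    nested_integral
      (\<lambda>j g. integral_along J \<gamma> (\<lambda>t. F t (z j) * (\<Prod>n<N. t - of_real (a n)) * g t)) M
      (\<lambda>s. vandermonde M s *
        nested_integral
          (\<lambda>l g. LINT t:I|lborel. (of_real t / y l) ^ (N - L) *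
             ((\<Prod>m<M. z m - of_real t) / (\<Prod>j<L. y j - of_real t)) * g t) L
          (\<lambda>v. vandermonde L (\<lambda>l. of_real (v l)) *
            nested_integral
              (\<lambda>l g. 1 / (2 * of_real pi * \<i>) * contour_integral (C s l)
                 (\<lambda>t. 1 / (\<Prod>n<N. t - of_real (a n)) *
                   (\<phi> t (of_real (v l)) / (\<Prod>j<M. s j - t)) * g t)) L
              (\<lambda>u. vandermonde L u)))"
proof -
  interpret invertible_polynomial_ensemble I J N \<phi>s a U \<phi> F \<pi> \<gamma>
    by unfold_locales (rule ensemble)
  define K where "K = N - L"
  have N: "N = L + K"
    using \<open>L \<le> N\<close> by (simp add: K_def)
  have "(LINT x|ensemble_measure I N \<phi>s. (\<Prod>m<M. char_fun N x (z m)) / (\<Prod>l<L. char_fun N x (y l)))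
      = reduced_sum z y M L K / (fact L * fact K * vandermonde M z * vandermonde N ca)"
    using assms by (intro expectation_eq_reduced_sum[OF N]) auto
  \<comment> \<open>The sign is its own inverse, so the prefactor of the theorem undoes the sign
    left by the residues.\<close>
  also have "\<dots> = (-1) ^ (L * (L - 1) div 2) / (of_nat (fact L) * vandermonde M z) *
      ((-1) ^ (L * (L - 1) div 2) / (fact K * vandermonde N ca) * reduced_sum z y M L K)"
    by (cases "even (L * (L - 1) div 2)") (simp_all add: mult_ac)
  finally show ?thesis
    using nested_integral_eq_reduced_sum[OF N assms(5) contours, unfolded ratio_kernel_def] by (simp only: K_def)
qed

end
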